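(* Let $G$ be a group, $M$ a right $\mathbb Z[G]$-module, $\varphi:G\to Z(G)$ a group homomorphism into the center of $G$, $X=M\times G$ the $G$-Alexander biquandle of $(M,\varphi)$, and $A$ an abelian group. (1) Let $f:M^2\to A$ be a $G$-invariant multilinear map. The birack $2$-cocycle $\Phi_f=f\circ\psi_2\circ\gamma_2:C_2^{\rm BR}(X;\mathbb Z)\to A$ is given by $$\Phi_f((m_1,g_1),(m_2,g_2))=f\bigl(m_1-m_2,\;m_2(1-\varphi(g_2)g_2^{-1})\bigr)$$ for all $((m_1,g_1),(m_2,g_2))\in X^2$. (2) Let $f:M^3\to A$ be a $G$-invariant multilinear map. The birack $3$-cocycle $\Phi_f=f\circ\psi_3\circ\gamma_3:C_3^{\rm BR}(X;\mathbb Z)\to A$ is given by $$\Phi_f((m_1,g_1),(m_2,g_2),(m_3,g_3))=f\bigl((m_1-m_2)(1-\varphi(g_2)^{-1}g_2),\;m_2-m_3,\;m_3(1-\varphi(g_3)g_3^{-1})\bigr)$$ for all $((m_1,g_1),(m_2,g_2),(m_3,g_3))\in X^3$.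
   Context: **$G$-Alexander biquandle.** $X=M\times G$ with the operations $(m,g)\,\underline{*}\,(n,h)=(mh+n(\varphi(h)-h),\,h^{-1}gh)$ and $(m,g)\,\overline{*}\,(n,h)=(m\varphi(h),\,g)$. **$G$-invariant multilinear maps.** Multilinear means additive in each variable. $f:M^n\to A$ is $G$-invariant if $f(m_1g,\dots,m_ng)=f(m_1,\dots,m_n)$ for all $g\in G$. Such an $f$ induces a homomorphism, also denoted $f:C_n^{\rm gp}(M;\mathbb Z)_G\to A$, which is a group $n$-cocycle. **Birack complex (trivial $X$-set).** $C_n^{\rm BR}(X;\mathbb Z)$ is the free abelian group on $X^n$ for $n\ge1$, and $0$ otherwise. For $n\ge2$, $$\partial_n^{\rm BR}(x_1,\dots,x_n)=\sum_{i=1}^n(-1)^{i-1}\{(x_1,\dots,x_{i-1},x_{i+1},\dots,x_n)-(x_1\underline{*}x_i,\dots,x_{i-1}\underline{*}x_i,x_{i+1}\overline{*}x_i,\dots,x_n\overline{*}x_i)\}.$$ A birack $n$-cocycle is a homomorphism $\Phi:C_n^{\rm BR}(X;\mathbb Z)\to A$ with $\Phi\circ\partial_{n+1}^{\rm BR}=0$. **Group chains.** $C_n^{\rm gp}(M;\mathbb Z)_G$ is the free abelian group on $M^n$ ($n\ge1$) modulo all $(m_1g,\dots,m_ng)-(m_1,\dots,m_n)$, $g\in G$. **The maps.** $C_n^{\rm BR_U}(X;\mathbb Z)$ is, for $n\ge1$, the free abelian group on $G^n\times M^n$, with generators written $(g_1,\dots,g_n;m_1,\dots,m_n)$. The homomorphism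 $\gamma_n:C_n^{\rm BR}(X;\mathbb Z)\to C_n^{\rm BR_U}(X;\mathbb Z)$ is $$\gamma_n((m_1,g_1),\dots,(m_n,g_n))=(g_1,\dots,g_n;\,m_1-m_2,\dots,m_{n-1}-m_n,\,m_n).$$ The homomorphism $\psi_n:C_n^{\rm BR_U}(X;\mathbb Z)\to C_n^{\rm gp}(M;\mathbb Z)_G$ is $$\psi_n(g_1,\dots,g_n;m_1,\dots,m_n)=\sum_{k}(-1)^{k_1+\cdots+k_n}(m_1\bm g_{k,1},\dots,m_n\bm g_{k,n}),$$ where $k=(k_1,\dots,k_n)$ runs over $\{0,1\}^n$ with $k_1=0$, and $\bm g_{k,i}=\varphi(g_1^{k_1}\cdots g_i^{k_i})\,g_{i+1}^{k_{i+1}}\cdots g_n^{k_n}\in G$. *)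

theory Defs
  imports "HOL-Algebra.Free_Abelian_Groups" "HOL-Algebra.Module"
begin

section \<open>Group rings and right modules\<close>

text \<open>
  The integral group ring of \<open>G\<close>: its elements are the finitely supported integer combinations of
  elements of \<open>G\<close>, so \<open>frag_of g\<close> is the basis element \<open>g\<close>, and addition and subtraction are those
  of the type \<open>'g \<Rightarrow>\<^sub>0 int\<close>.
\<close>

definition group_ring :: "('g, 'b) monoid_scheme \<Rightarrow> ('g \<Rightarrow>\<^sub>0 int) ring" where
  "group_ring G =
     \<lparr>carrier = carrier (free_Abelian_group (carrier G)),
      monoid.mult = (\<lambda>a b. frag_extend (\<lambda>g. frag_extend (\<lambda>h. frag_of (g \<otimes>\<^bsub>G\<^esub> h)) b) a),
      one = frag_of \<one>\<^bsub>G\<^esub>,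
      zero = 0,
      add = (+)\<rparr>"

text \<open>The library's \<^locale>\<open>module\<close> requires a commutative ring of scalars, hence the following.\<close>

locale right_module = R?: ring R + M?: abelian_group M
    for R (structure) and M (structure) +
  fixes act :: "'c \<Rightarrow> 'a \<Rightarrow> 'c"
  assumes act_closed [simp, intro]:
      "\<lbrakk>x \<in> carrier M; a \<in> carrier R\<rbrakk> \<Longrightarrow> act x a \<in> carrier M"
    and act_add_left:
      "\<lbrakk>x \<in> carrier M; y \<in> carrier M; a \<in> carrier R\<rbrakk> \<Longrightarrow>
        act (x \<oplus>\<^bsub>M\<^esub> y) a = act x a \<oplus>\<^bsub>M\<^esub> act y a"
    and act_add_right:
      "\<lbrakk>x \<in> carrier M; a \<in> carrier R; b \<in> carrier R\<rbrakk> \<Longrightarrow>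
        act x (a \<oplus>\<^bsub>R\<^esub> b) = act x a \<oplus>\<^bsub>M\<^esub> act x b"
    and act_mult:
      "\<lbrakk>x \<in> carrier M; a \<in> carrier R; b \<in> carrier R\<rbrakk> \<Longrightarrow>
        act x (a \<otimes>\<^bsub>R\<^esub> b) = act (act x a) b"
    and act_one [simp]:
      "x \<in> carrier M \<Longrightarrow> act x \<one>\<^bsub>R\<^esub> = x"

definition center :: "('g, 'b) monoid_scheme \<Rightarrow> 'g set" where
  "center G = {z \<in> carrier G. \<forall>g\<in>carrier G. z \<otimes>\<^bsub>G\<^esub> g = g \<otimes>\<^bsub>G\<^esub> z}"

section \<open>The \<open>G\<close>-Alexander biquandle\<close>

definition alex_carrier ::
    "('g, 'b) monoid_scheme \<Rightarrow> ('m, 'c) ring_scheme \<Rightarrow> ('m \<times> 'g) set" where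
  "alex_carrier G M = carrier M \<times> carrier G"

fun alex_under ::
    "('g, 'b) monoid_scheme \<Rightarrow> ('m, 'c) ring_scheme \<Rightarrow> ('m \<Rightarrow> ('g \<Rightarrow>\<^sub>0 int) \<Rightarrow> 'm) \<Rightarrow> ('g \<Rightarrow> 'g)
      \<Rightarrow> 'm \<times> 'g \<Rightarrow> 'm \<times> 'g \<Rightarrow> 'm \<times> 'g" where
  "alex_under G M act \<phi> (m, g) (n, h) =
     (act m (frag_of h) \<oplus>\<^bsub>M\<^esub> act n (frag_of (\<phi> h) - frag_of h),
      inv\<^bsub>G\<^esub> h \<otimes>\<^bsub>G\<^esub> g \<otimes>\<^bsub>G\<^esub> h)"

fun alex_over ::
    "('m \<Rightarrow> ('g \<Rightarrow>\<^sub>0 int) \<Rightarrow> 'm) \<Rightarrow> ('g \<Rightarrow> 'g) \<Rightarrow> 'm \<times> 'g \<Rightarrow> 'm \<times> 'g \<Rightarrow> 'm \<times> 'g" where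
  "alex_over act \<phi> (m, g) (n, h) = (act m (frag_of (\<phi> h)), g)"

section \<open>The birack complex with trivial \<open>X\<close>-set\<close>

text \<open>The Cartesian power \<open>S\<^sup>n\<close>; the entries of a tuple are indexed from 0.\<close>

definition tuples :: "nat \<Rightarrow> 'a set \<Rightarrow> 'a list set" where
  "tuples n S = {xs. set xs \<subseteq> S \<and> length xs = n}"

text \<open>\<open>free_Abelian_group {}\<close> is the trivial group.\<close>

definition birack_chains :: "nat \<Rightarrow> 'x set \<Rightarrow> ('x list \<Rightarrow>\<^sub>0 int) monoid" where
  "birack_chains n X = free_Abelian_group (if n \<ge> 1 then tuples n X else {})"

definition birack_boundary ::
    "('x \<Rightarrow> 'x \<Rightarrow> 'x) \<Rightarrow> ('x \<Rightarrow> 'x \<Rightarrow> 'x) \<Rightarrow> nat \<Rightarrow> ('x list \<Rightarrow>\<^sub>0 int) \<Rightarrow> ('x list \<Rightarrow>\<^sub>0 int)" where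
  "birack_boundary us os n =
     (if n \<ge> 2 then
        frag_extend (\<lambda>xs. \<Sum>i<n. frag_cmul ((-1) ^ i)
          (frag_of (take i xs @ drop (Suc i) xs)
           - frag_of (map (\<lambda>x. us x (xs ! i)) (take i xs)
                      @ map (\<lambda>x. os x (xs ! i)) (drop (Suc i) xs))))
      else (\<lambda>_. 0))"

definition birack_cocycle ::
    "('x \<Rightarrow> 'x \<Rightarrow> 'x) \<Rightarrow> ('x \<Rightarrow> 'x \<Rightarrow> 'x) \<Rightarrow> nat \<Rightarrow> 'x set \<Rightarrow> ('a, 'd) ring_scheme
      \<Rightarrow> (('x list \<Rightarrow>\<^sub>0 int) \<Rightarrow> 'a) \<Rightarrow> bool" where
  "birack_cocycle us os n X A \<Phi> \<longleftrightarrow>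
     \<Phi> \<in> hom (birack_chains n X) (add_monoid A) \<and>
     (\<forall>c \<in> carrier (birack_chains (Suc n) X). \<Phi> (birack_boundary us os (Suc n) c) = \<zero>\<^bsub>A\<^esub>)"

section \<open>Group chains and \<open>G\<close>-invariant multilinear maps\<close>

definition gp_free :: "nat \<Rightarrow> ('m, 'c) ring_scheme \<Rightarrow> ('m list \<Rightarrow>\<^sub>0 int) monoid" where
  "gp_free n M = free_Abelian_group (if n \<ge> 1 then tuples n (carrier M) else {})"

definition gp_relations ::
    "('g, 'b) monoid_scheme \<Rightarrow> ('m, 'c) ring_scheme \<Rightarrow> ('m \<Rightarrow> ('g \<Rightarrow>\<^sub>0 int) \<Rightarrow> 'm) \<Rightarrow> nat
      \<Rightarrow> ('m list \<Rightarrow>\<^sub>0 int) set" where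
  "gp_relations G M act n =
     generate (gp_free n M)
       {frag_of (map (\<lambda>m. act m (frag_of g)) ms) - frag_of ms | ms g.
          n \<ge> 1 \<and> ms \<in> tuples n (carrier M) \<and> g \<in> carrier G}"

definition gp_chains ::
    "('g, 'b) monoid_scheme \<Rightarrow> ('m, 'c) ring_scheme \<Rightarrow> ('m \<Rightarrow> ('g \<Rightarrow>\<^sub>0 int) \<Rightarrow> 'm) \<Rightarrow> nat
      \<Rightarrow> ('m list \<Rightarrow>\<^sub>0 int) set monoid" where
  "gp_chains G M act n = gp_free n M Mod gp_relations G M act n"

definition multilinear_map ::
    "nat \<Rightarrow> ('m, 'c) ring_scheme \<Rightarrow> ('a, 'd) ring_scheme \<Rightarrow> ('m list \<Rightarrow> 'a) \<Rightarrow> bool" where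
  "multilinear_map n M A f \<longleftrightarrow>
     (\<forall>ms \<in> tuples n (carrier M). f ms \<in> carrier A) \<and>
     (\<forall>ms \<in> tuples n (carrier M). \<forall>i<n. \<forall>x\<in>carrier M. \<forall>y\<in>carrier M.
        f (ms[i := x \<oplus>\<^bsub>M\<^esub> y]) = f (ms[i := x]) \<oplus>\<^bsub>A\<^esub> f (ms[i := y]))"

definition invariant_map ::
    "('g, 'b) monoid_scheme \<Rightarrow> ('m, 'c) ring_scheme \<Rightarrow> ('m \<Rightarrow> ('g \<Rightarrow>\<^sub>0 int) \<Rightarrow> 'm) \<Rightarrow> nat
      \<Rightarrow> ('m list \<Rightarrow> 'a) \<Rightarrow> bool" where
  "invariant_map G M act n f \<longleftrightarrow>
     (\<forall>ms \<in> tuples n (carrier M). \<forall>g\<in>carrier G. f (map (\<lambda>m. act m (frag_of g)) ms) = f ms)"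

text \<open>The \<open>\<int>\<close>-linear extension of \<open>f\<close> to formal sums.\<close>

definition lin_extend :: "('a, 'd) ring_scheme \<Rightarrow> ('x \<Rightarrow> 'a) \<Rightarrow> ('x \<Rightarrow>\<^sub>0 int) \<Rightarrow> 'a" where
  "lin_extend A f c =
     (\<Oplus>\<^bsub>A\<^esub> x \<in> Poly_Mapping.keys c. [Poly_Mapping.lookup c x] \<cdot>\<^bsub>A\<^esub> f x)"

text \<open>
  The homomorphism induced on \<^const>\<open>gp_chains\<close>: a chain is a coset of formal sums, and for
  \<open>G\<close>-invariant \<open>f\<close> the linear extension is constant on it (\<open>gp_induced_class\<close>, \<open>gp_induced_hom\<close> below).
\<close>

definition gp_induced :: "('a, 'd) ring_scheme \<Rightarrow> ('m list \<Rightarrow> 'a) \<Rightarrow> ('m list \<Rightarrow>\<^sub>0 int) set \<Rightarrow> 'a" where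
  "gp_induced A f C = the_elem (lin_extend A f ` C)"

section \<open>The maps \<open>\<gamma>\<close> and \<open>\<psi>\<close>\<close>

text \<open>A generator \<open>(g\<^sub>1, \<dots>, g\<^sub>n; m\<^sub>1, \<dots>, m\<^sub>n)\<close> is a pair of lists.\<close>

definition birackU_chains ::
    "('g, 'b) monoid_scheme \<Rightarrow> ('m, 'c) ring_scheme \<Rightarrow> nat \<Rightarrow> ('g list \<times> 'm list \<Rightarrow>\<^sub>0 int) monoid" where
  "birackU_chains G M n =
     free_Abelian_group (if n \<ge> 1 then tuples n (carrier G) \<times> tuples n (carrier M) else {})"

definition gamma_map ::
    "('m, 'c) ring_scheme \<Rightarrow> nat \<Rightarrow> (('m \<times> 'g) list \<Rightarrow>\<^sub>0 int) \<Rightarrow> ('g list \<times> 'm list \<Rightarrow>\<^sub>0 int)" where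
  "gamma_map M n =
     frag_extend (\<lambda>xs. frag_of
       (map snd xs,
        map (\<lambda>i. if Suc i < n then fst (xs ! i) \<ominus>\<^bsub>M\<^esub> fst (xs ! Suc i) else fst (xs ! i)) [0..<n]))"

definition list_prod :: "('g, 'b) monoid_scheme \<Rightarrow> 'g list \<Rightarrow> 'g" where
  "list_prod G gs = foldr (\<otimes>\<^bsub>G\<^esub>) gs \<one>\<^bsub>G\<^esub>"

text \<open>
  \<open>psi_coeff G \<phi> gs ks i\<close> is \<open>\<phi> (g\<^sub>1^k\<^sub>1 \<cdots> g\<^sub>i^k\<^sub>i) \<otimes> (g\<^sub>j^k\<^sub>j \<cdots> g\<^sub>n^k\<^sub>n)\<close> with \<open>j = i + 1\<close>; here \<open>i\<close> counts from 1.
\<close>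

definition psi_coeff ::
    "('g, 'b) monoid_scheme \<Rightarrow> ('g \<Rightarrow> 'g) \<Rightarrow> 'g list \<Rightarrow> nat list \<Rightarrow> nat \<Rightarrow> 'g" where
  "psi_coeff G \<phi> gs ks i =
     (let ps = map2 (\<lambda>g k. g [^]\<^bsub>G\<^esub> k) gs ks
      in \<phi> (list_prod G (take i ps)) \<otimes>\<^bsub>G\<^esub> list_prod G (drop i ps))"

definition psi_indices :: "nat \<Rightarrow> nat list set" where
  "psi_indices n = {ks \<in> tuples n {0, 1}. ks ! 0 = 0}"

definition psi_map ::
    "('g, 'b) monoid_scheme \<Rightarrow> ('m, 'c) ring_scheme \<Rightarrow> ('m \<Rightarrow> ('g \<Rightarrow>\<^sub>0 int) \<Rightarrow> 'm) \<Rightarrow> ('g \<Rightarrow> 'g) \<Rightarrow> nat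
      \<Rightarrow> ('g list \<times> 'm list \<Rightarrow>\<^sub>0 int) \<Rightarrow> ('m list \<Rightarrow>\<^sub>0 int) set" where
  "psi_map G M act \<phi> n c =
     gp_relations G M act n #>\<^bsub>gp_free n M\<^esub>
       frag_extend (\<lambda>(gs, ms). \<Sum>ks \<in> psi_indices n. frag_cmul ((-1) ^ sum_list ks)
         (frag_of (map (\<lambda>i. act (ms ! i) (frag_of (psi_coeff G \<phi> gs ks (Suc i)))) [0..<n]))) c"

definition birack_cochain ::
    "('g, 'b) monoid_scheme \<Rightarrow> ('m, 'c) ring_scheme \<Rightarrow> ('m \<Rightarrow> ('g \<Rightarrow>\<^sub>0 int) \<Rightarrow> 'm) \<Rightarrow> ('g \<Rightarrow> 'g)
      \<Rightarrow> ('a, 'd) ring_scheme \<Rightarrow> nat \<Rightarrow> ('m list \<Rightarrow> 'a) \<Rightarrow> (('m \<times> 'g) list \<Rightarrow>\<^sub>0 int) \<Rightarrow> 'a" where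
  "birack_cochain G M act \<phi> A n f = gp_induced A f \<circ> psi_map G M act \<phi> n \<circ> gamma_map M n"

section \<open>Well-definedness\<close>

lemma group_ring_ring:
  assumes "group G"
  shows "ring (group_ring G)"
proof -
  interpret G: group G by fact
  let ?m = "\<lambda>a b. frag_extend (\<lambda>g. frag_extend (\<lambda>h. frag_of (g \<otimes>\<^bsub>G\<^esub> h)) b) a"
  have addl: "?m (a + b) c = ?m a c + ?m b c" for a b c
    by (simp add: frag_extend_add)
  have subl: "?m (a - b) c = ?m a c - ?m b c" for a b c
    by (simp add: frag_extend_diff)
  have subr: "?m a (b - c) = ?m a b - ?m a c" for a b c
    using subset_UNIV[of "Poly_Mapping.keys a"]
    by (induction a rule: frag_induction) (auto simp: frag_extend_diff)
  have addr: "?m a (b + c) = ?m a b + ?m a c" for a b c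
    using subset_UNIV[of "Poly_Mapping.keys a"]
    by (induction a rule: frag_induction) (auto simp: frag_extend_diff frag_extend_add)
  have zr: "?m a 0 = 0" for a
    by (metis subr diff_self)
  have closed: "Poly_Mapping.keys (?m a b) \<subseteq> carrier G"
    if "Poly_Mapping.keys a \<subseteq> carrier G" "Poly_Mapping.keys b \<subseteq> carrier G" for a b
  proof -
    have "Poly_Mapping.keys (frag_extend (\<lambda>h. frag_of (g \<otimes>\<^bsub>G\<^esub> h)) b) \<subseteq> carrier G"
      if "g \<in> carrier G" for g
      using keys_frag_extend[of "\<lambda>h. frag_of (g \<otimes>\<^bsub>G\<^esub> h)" b] that \<open>Poly_Mapping.keys b \<subseteq> carrier G\<close>
      by fastforce
    with that keys_frag_extend[of "\<lambda>g. frag_extend (\<lambda>h. frag_of (g \<otimes>\<^bsub>G\<^esub> h)) b" a]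
    show ?thesis by blast
  qed
  have one_l: "?m (frag_of \<one>\<^bsub>G\<^esub>) a = a" if "Poly_Mapping.keys a \<subseteq> carrier G" for a
    using that by (induction a rule: frag_induction) (simp_all add: frag_extend_diff)
  have one_r: "?m a (frag_of \<one>\<^bsub>G\<^esub>) = a" if "Poly_Mapping.keys a \<subseteq> carrier G" for a
    using that by (induction a rule: frag_induction) (simp_all add: frag_extend_diff)
  have assoc1: "?m (?m (frag_of g) (frag_of h)) c = ?m (frag_of g) (?m (frag_of h) c)"
    if "g \<in> carrier G" "h \<in> carrier G" "Poly_Mapping.keys c \<subseteq> carrier G" for g h c
    using that(3)
    by (induction c rule: frag_induction)
      (simp_all add: frag_extend_diff G.m_assoc that)
  have assoc2: "?m (?m (frag_of g) b) c = ?m (frag_of g) (?m b c)"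
    if "g \<in> carrier G" "Poly_Mapping.keys b \<subseteq> carrier G" "Poly_Mapping.keys c \<subseteq> carrier G" for g b c
    using that(2)
  proof (induction b rule: frag_induction)
    case (one h)
    then show ?case using assoc1 that by blast
  qed (simp_all add: frag_extend_diff)
  have assoc: "?m (?m a b) c = ?m a (?m b c)"
    if "Poly_Mapping.keys a \<subseteq> carrier G" "Poly_Mapping.keys b \<subseteq> carrier G"
      "Poly_Mapping.keys c \<subseteq> carrier G" for a b c
    using that(1)
  proof (induction a rule: frag_induction)
    case (one g)
    then show ?case using assoc2 that by blast
  qed (simp_all add: frag_extend_diff)
  show ?thesis
  proof (rule ringI)
    show "abelian_group (group_ring G)"
    proof (rule abelian_groupI)
      fix x assume "x \<in> carrier (group_ring G)"
      then show "\<exists>y\<in>carrier (group_ring G). y \<oplus>\<^bsub>group_ring G\<^esub> x = \<zero>\<^bsub>group_ring G\<^esub>"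
        by (intro bexI[of _ "- x"]) (simp_all add: group_ring_def)
    qed (use keys_add in \<open>fastforce simp: group_ring_def add.assoc add.commute\<close>)+
    show "Group.monoid (group_ring G)"
      by (rule monoidI) (simp_all add: group_ring_def closed one_l[simplified] one_r[simplified] assoc)
  qed (simp_all add: group_ring_def addl addr)
qed

lemma lin_extend_hom:
  assumes "abelian_group A" and f: "\<And>x. x \<in> S \<Longrightarrow> f x \<in> carrier A"
  shows "lin_extend A f \<in> hom (free_Abelian_group S) (add_monoid A)"
proof -
  interpret A: abelian_group A by fact
  have null: "[(0::int)] \<cdot>\<^bsub>A\<^esub> y = \<zero>\<^bsub>A\<^esub>" for y
    using int_pow_0[of "add_monoid A" y] by (simp only: add_pow_def monoid.simps)
  have distr: "[(k + l)] \<cdot>\<^bsub>A\<^esub> y = [k] \<cdot>\<^bsub>A\<^esub> y \<oplus>\<^bsub>A\<^esub> [l] \<cdot>\<^bsub>A\<^esub> y"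
    if "y \<in> carrier A" for k l :: int and y
    using group.int_pow_mult[OF A.a_group, of y k l] that by (simp add: add_pow_def)
  have wider: "lin_extend A f c = (\<Oplus>\<^bsub>A\<^esub> x \<in> F. [Poly_Mapping.lookup c x] \<cdot>\<^bsub>A\<^esub> f x)"
    if "finite F" "Poly_Mapping.keys c \<subseteq> F" "F \<subseteq> S" for c F
    unfolding lin_extend_def
    by (rule A.add.finprod_mono_neutral_cong_left)
      (use that f in \<open>auto simp: in_keys_iff null\<close>)
  show ?thesis
  proof (rule homI)
    fix c assume "c \<in> carrier (free_Abelian_group S)"
    then show "lin_extend A f c \<in> carrier (add_monoid A)"
      using f by (auto simp: lin_extend_def intro!: A.finsum_closed)
  next
    fix a b assume ab: "a \<in> carrier (free_Abelian_group S)" "b \<in> carrier (free_Abelian_group S)"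
    let ?F = "Poly_Mapping.keys a \<union> Poly_Mapping.keys b"
    have F: "finite ?F" "?F \<subseteq> S" "Poly_Mapping.keys (a + b) \<subseteq> ?F"
      using ab keys_add[of a b] by auto
    have "lin_extend A f (a + b) =
        (\<Oplus>\<^bsub>A\<^esub> x \<in> ?F. [Poly_Mapping.lookup a x] \<cdot>\<^bsub>A\<^esub> f x \<oplus>\<^bsub>A\<^esub> [Poly_Mapping.lookup b x] \<cdot>\<^bsub>A\<^esub> f x)"
      unfolding wider[OF F(1,3,2)]
      by (rule A.finsum_cong') (use F f in \<open>auto simp: lookup_add distr\<close>)
    also have "\<dots> = lin_extend A f a \<oplus>\<^bsub>A\<^esub> lin_extend A f b"
      using F f wider[of ?F a] wider[of ?F b] by (subst A.finsum_addf) auto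
    finally show "lin_extend A f (a \<otimes>\<^bsub>free_Abelian_group S\<^esub> b) =
        lin_extend A f a \<otimes>\<^bsub>add_monoid A\<^esub> lin_extend A f b"
      by simp
  qed
qed

lemma lin_extend_frag_of:
  assumes "abelian_group A" "f x \<in> carrier A"
  shows "lin_extend A f (frag_of x) = f x"
proof -
  interpret A: abelian_group A by fact
  have "(\<Oplus>\<^bsub>A\<^esub> y \<in> {x}. [Poly_Mapping.lookup (frag_of x) y] \<cdot>\<^bsub>A\<^esub> f y) = f x"
    using assms(2) A.finsum_insert[of "{}" x "\<lambda>y. [Poly_Mapping.lookup (frag_of x) y] \<cdot>\<^bsub>A\<^esub> f y"]
    by auto
  then show ?thesis
    by (simp add: lin_extend_def)
qed

lemma gp_induced_class:
  assumes "group G" "right_module (group_ring G) M act" "abelian_group A"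
    and f: "multilinear_map n M A f" "invariant_map G M act n f"
    and c: "c \<in> carrier (gp_free n M)"
  shows "gp_induced A f (gp_relations G M act n #>\<^bsub>gp_free n M\<^esub> c) = lin_extend A f c"
proof -
  interpret A: abelian_group A by fact
  interpret M: right_module "group_ring G" M act by fact
  define S where "S = (if n \<ge> 1 then tuples n (carrier M) else {})"
  have F: "gp_free n M = free_Abelian_group S"
    by (simp add: gp_free_def S_def)
  have fS: "f x \<in> carrier A" if "x \<in> S" for x
    using f(1) that by (auto simp: multilinear_map_def S_def split: if_splits)
  interpret L: group_hom "free_Abelian_group S" "add_monoid A" "lin_extend A f"
    by (intro group_hom.intro group_hom_axioms.intro lin_extend_hom A.a_group assms fS) simp_all
  let ?K = "kernel (free_Abelian_group S) (add_monoid A) (lin_extend A f)"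
  have "gp_relations G M act n \<subseteq> ?K"
    unfolding gp_relations_def F
  proof (rule L.generate_subgroup_incl[OF _ L.subgroup_kernel], clarify)
    fix ms g assume n: "1 \<le> n" and ms: "ms \<in> tuples n (carrier M)" and g: "g \<in> carrier G"
    let ?ms' = "map (\<lambda>m. act m (frag_of g)) ms"
    have "frag_of g \<in> carrier (group_ring G)"
      using g by (simp add: group_ring_def)
    then have S: "ms \<in> S" "?ms' \<in> S"
      using n ms by (auto simp: S_def tuples_def)
    let ?d = "frag_of ?ms' - frag_of ms"
    have d: "?d \<in> carrier (free_Abelian_group S)"
      using S keys_diff[of "frag_of ?ms'" "frag_of ms"] by auto
    have "lin_extend A f (?d + frag_of ms) = lin_extend A f ?d \<oplus>\<^bsub>A\<^esub> lin_extend A f (frag_of ms)"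
      using L.hom_mult[OF d, of "frag_of ms"] S by simp
    moreover have "lin_extend A f (?d + frag_of ms) = lin_extend A f (frag_of ms)"
      using f(2) S fS ms g by (simp add: lin_extend_frag_of assms invariant_map_def)
    ultimately have "lin_extend A f ?d = \<zero>\<^bsub>A\<^esub>"
      using L.hom_closed[OF d] fS[OF S(1)] by (simp add: lin_extend_frag_of assms)
    with d show "?d \<in> ?K"
      by (simp add: kernel_def)
  qed
  then have const: "lin_extend A f x = lin_extend A f c"
    if x: "x \<in> gp_relations G M act n #>\<^bsub>gp_free n M\<^esub> c" for x
  proof -
    obtain r where r: "r \<in> ?K" "x = r + c"
      using x \<open>gp_relations G M act n \<subseteq> ?K\<close> by (auto simp: F r_coset_def)
    have "r \<in> carrier (free_Abelian_group S)" "lin_extend A f r = \<zero>\<^bsub>A\<^esub>"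
      using r(1) unfolding kernel_def by simp_all
    then have "lin_extend A f (r + c) = \<zero>\<^bsub>A\<^esub> \<oplus>\<^bsub>A\<^esub> lin_extend A f c"
      using L.hom_mult[of r c] c unfolding F by simp
    then show ?thesis
      using r(2) L.hom_closed[of c] c unfolding F by simp
  qed
  have "0 \<in> gp_relations G M act n"
    using generate.one[of "gp_free n M"] by (simp add: gp_relations_def F)
  then have "gp_relations G M act n #>\<^bsub>gp_free n M\<^esub> c \<noteq> {}"
    by (auto simp: r_coset_def)
  then show ?thesis
    unfolding gp_induced_def using const by (rule the_elem_image_unique)
qed

lemma frag_extend_hom:
  assumes "\<And>x. x \<in> S \<Longrightarrow> Poly_Mapping.keys (f x) \<subseteq> T"
  shows "frag_extend f \<in> hom (free_Abelian_group S) (free_Abelian_group T)"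
proof (rule homI)
  fix c assume "c \<in> carrier (free_Abelian_group S)"
  with assms keys_frag_extend[of f c]
  show "frag_extend f c \<in> carrier (free_Abelian_group T)"
    unfolding carrier_free_Abelian_group_iff by blast
qed (simp add: frag_extend_add)

lemma gamma_map_hom:
  assumes "abelian_group M"
  shows "gamma_map M n \<in> hom (birack_chains n (alex_carrier G M)) (birackU_chains G M n)"
proof -
  interpret M: abelian_group M by fact
  have "(map snd xs, map (\<lambda>i. if Suc i < n then fst (xs ! i) \<ominus>\<^bsub>M\<^esub> fst (xs ! Suc i) else fst (xs ! i)) [0..<n])
      \<in> tuples n (carrier G) \<times> tuples n (carrier M)"
    if xs: "xs \<in> tuples n (alex_carrier G M)" for xs
  proof -
    have "xs ! i \<in> carrier M \<times> carrier G" if "i < n" for i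
      using xs that nth_mem[of i xs] by (auto simp: tuples_def alex_carrier_def)
    then have "fst (xs ! i) \<in> carrier M" if "i < n" for i
      using that by (metis mem_Times_iff)
    with xs show ?thesis
      by (auto simp: tuples_def alex_carrier_def intro!: M.minus_closed)
  qed
  then show ?thesis
    unfolding gamma_map_def birack_chains_def birackU_chains_def
    by (intro frag_extend_hom) (auto split: if_splits)
qed

lemma list_prod_closed:
  assumes "group G" "set gs \<subseteq> carrier G"
  shows "list_prod G gs \<in> carrier G"
proof -
  interpret G: group G by fact
  show ?thesis
    using assms(2) by (induction gs) (simp_all add: list_prod_def)
qed

lemma psi_coeff_closed:
  assumes "group G" "\<phi> \<in> carrier G \<rightarrow> carrier G" "set gs \<subseteq> carrier G"
  shows "psi_coeff G \<phi> gs ks i \<in> carrier G"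
proof -
  interpret G: group G by fact
  let ?ps = "map2 (\<lambda>g k. g [^]\<^bsub>G\<^esub> k) gs ks"
  have ps: "set ?ps \<subseteq> carrier G"
    using assms(3) by (auto dest: set_zip_leftD)
  then have "set (take i ?ps) \<subseteq> carrier G" "set (drop i ?ps) \<subseteq> carrier G"
    using set_take_subset set_drop_subset by (meson order_trans)+
  then have "list_prod G (take i ?ps) \<in> carrier G" "list_prod G (drop i ?ps) \<in> carrier G"
    by (simp_all only: list_prod_closed assms(1))
  then show ?thesis
    using assms(2) unfolding psi_coeff_def Let_def by blast
qed

lemma gp_relations_normal:
  assumes "right_module (group_ring G) M act"
  shows "gp_relations G M act n \<lhd> gp_free n M"
proof -
  interpret M: right_module "group_ring G" M act by fact
  let ?rels = "{frag_of (map (\<lambda>m. act m (frag_of g)) ms) - frag_of ms | ms g.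
    n \<ge> 1 \<and> ms \<in> tuples n (carrier M) \<and> g \<in> carrier G}"
  let ?T = "if n \<ge> 1 then tuples n (carrier M) else {}"
  interpret F: comm_group "gp_free n M"
    unfolding gp_free_def by (rule abelian_free_Abelian_group)
  have act: "act m (frag_of g) \<in> carrier M" if "m \<in> carrier M" "g \<in> carrier G" for m g
    using that by (intro M.act_closed) (simp_all add: group_ring_def)
  have rels: "?rels \<subseteq> carrier (gp_free n M)"
  proof clarify
    fix ms g assume n: "1 \<le> n" and ms: "ms \<in> tuples n (carrier M)" and g: "g \<in> carrier G"
    then have "map (\<lambda>m. act m (frag_of g)) ms \<in> ?T" "ms \<in> ?T"
      using act by (auto simp: tuples_def)
    then have "Poly_Mapping.keys (frag_of (map (\<lambda>m. act m (frag_of g)) ms) - frag_of ms) \<subseteq> ?T"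
      using keys_diff[of "frag_of (map (\<lambda>m. act m (frag_of g)) ms)" "frag_of ms"]
      unfolding keys_frag_of by blast
    then show "frag_of (map (\<lambda>m. act m (frag_of g)) ms) - frag_of ms \<in> carrier (gp_free n M)"
      by (simp only: gp_free_def carrier_free_Abelian_group_iff)
  qed
  have "subgroup (gp_relations G M act n) (gp_free n M)"
    unfolding gp_relations_def by (rule F.generate_is_subgroup[OF rels])
  then show ?thesis
    by (rule F.subgroup_imp_normal)
qed

lemma psi_map_hom:
  assumes "group G" "right_module (group_ring G) M act" "\<phi> \<in> carrier G \<rightarrow> carrier G"
  shows "psi_map G M act \<phi> n \<in> hom (birackU_chains G M n) (gp_chains G M act n)"
proof -
  interpret M: right_module "group_ring G" M act by fact
  let ?T = "if n \<ge> 1 then tuples n (carrier M) else {}"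
  let ?h = "\<lambda>(gs, ms). \<Sum>ks \<in> psi_indices n. frag_cmul ((-1) ^ sum_list ks)
         (frag_of (map (\<lambda>i. act (ms ! i) (frag_of (psi_coeff G \<phi> gs ks (Suc i)))) [0..<n]))"
  interpret N: normal "gp_relations G M act n" "gp_free n M"
    by (rule gp_relations_normal) fact
  have act: "act m (frag_of g) \<in> carrier M" if "m \<in> carrier M" "g \<in> carrier G" for m g
    using that by (intro M.act_closed) (simp_all add: group_ring_def)
  have "Poly_Mapping.keys (?h x) \<subseteq> ?T"
    if x: "x \<in> (if n \<ge> 1 then tuples n (carrier G) \<times> tuples n (carrier M) else {})" for x
  proof -
    obtain gs ms where x': "x = (gs, ms)" "gs \<in> tuples n (carrier G)" "ms \<in> tuples n (carrier M)" "n \<ge> 1"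
      using x by (auto split: if_splits)
    have "map (\<lambda>i. act (ms ! i) (frag_of (psi_coeff G \<phi> gs ks (Suc i)))) [0..<n] \<in> tuples n (carrier M)" for ks
    proof -
      have "ms ! i \<in> carrier M" if "i < n" for i
        using x'(3) that nth_mem[of i ms] by (auto simp: tuples_def)
      moreover have "psi_coeff G \<phi> gs ks i \<in> carrier G" for i
        using x'(2) by (intro psi_coeff_closed assms) (simp add: tuples_def)
      ultimately show ?thesis
        using act by (auto simp: tuples_def)
    qed
    then have "(\<Sum>ks \<in> psi_indices n. frag_cmul ((-1) ^ sum_list ks)
         (frag_of (map (\<lambda>i. act (ms ! i) (frag_of (psi_coeff G \<phi> gs ks (Suc i)))) [0..<n])))
         \<in> carrier (free_Abelian_group (tuples n (carrier M)))"
      by (intro sum_closed_free_Abelian_group) (auto simp: subset_iff)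
    then show ?thesis
      using x' by simp
  qed
  then have "frag_extend ?h \<in> hom (birackU_chains G M n) (gp_free n M)"
    unfolding birackU_chains_def gp_free_def by (rule frag_extend_hom)
  from Group.hom_compose[OF this N.r_coset_hom_Mod] show ?thesis
    by (simp add: psi_map_def[abs_def] gp_chains_def comp_def)
qed

lemma gp_induced_hom:
  assumes "group G" "right_module (group_ring G) M act" "abelian_group A"
    and f: "multilinear_map n M A f" "invariant_map G M act n f"
  shows "gp_induced A f \<in> hom (gp_chains G M act n) (add_monoid A)"
proof -
  interpret A: abelian_group A by fact
  interpret N: normal "gp_relations G M act n" "gp_free n M"
    by (rule gp_relations_normal) fact
  note on_coset = gp_induced_class[OF assms]
  have hom: "lin_extend A f \<in> hom (gp_free n M) (add_monoid A)"
    unfolding gp_free_def using f(1)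
    by (intro lin_extend_hom assms) (auto simp: multilinear_map_def split: if_splits)
  show ?thesis
  proof (rule homI)
    fix C assume "C \<in> carrier (gp_chains G M act n)"
    then obtain c where "c \<in> carrier (gp_free n M)" "C = gp_relations G M act n #>\<^bsub>gp_free n M\<^esub> c"
      by (auto simp: gp_chains_def FactGroup_def RCOSETS_def)
    then show "gp_induced A f C \<in> carrier (add_monoid A)"
      using hom_in_carrier[OF hom] on_coset by simp
  next
    fix C D assume "C \<in> carrier (gp_chains G M act n)" "D \<in> carrier (gp_chains G M act n)"
    then obtain c d where
      c: "c \<in> carrier (gp_free n M)" "C = gp_relations G M act n #>\<^bsub>gp_free n M\<^esub> c" and
      d: "d \<in> carrier (gp_free n M)" "D = gp_relations G M act n #>\<^bsub>gp_free n M\<^esub> d"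
      by (auto simp: gp_chains_def FactGroup_def RCOSETS_def)
    have "C \<otimes>\<^bsub>gp_chains G M act n\<^esub> D =
        gp_relations G M act n #>\<^bsub>gp_free n M\<^esub> (c \<otimes>\<^bsub>gp_free n M\<^esub> d)"
      using c d by (simp add: gp_chains_def FactGroup_def N.rcos_sum)
    then show "gp_induced A f (C \<otimes>\<^bsub>gp_chains G M act n\<^esub> D) =
        gp_induced A f C \<otimes>\<^bsub>add_monoid A\<^esub> gp_induced A f D"
      using c d hom_mult[OF hom c(1) d(1)] by (simp only: on_coset N.m_closed)
  qed
qed

end

theory Submission
  imports Defs
begin

text \<open>
  Two endomorphisms of \<open>M\<close> govern everything: \<open>\<delta> g m = m (1 - \<phi>(g) g\<^sup>-\<^sup>1)\<close> and
  \<open>\<delta>' g m = m (1 - \<phi>(g)\<^sup>-\<^sup>1 g)\<close>. For an invariant multilinear \<open>f\<close>, the difference between \<open>f\<close> at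
  a tuple and \<open>f\<close> at the same tuple with all entries but the last multiplied by \<open>g\<close>, and the last
  by \<open>\<phi>(g)\<close>, is \<open>f\<close> with \<open>\<delta> g\<close> applied to the last entry: by invariance the second tuple may be
  multiplied by \<open>g\<^sup>-\<^sup>1\<close>, and then the two tuples differ in one entry only
  (\<open>twist_absorbed_last\<close>). Call the second tuple the twist of the first, at its last entry, by \<open>g\<close>.
  Symmetrically, \<open>\<delta>' g\<close> arises from a twist at the first entry, where only that entry is multiplied
  by \<open>g\<close> and the others by \<open>\<phi>(g)\<close> (\<open>twist_absorbed_first\<close>). For \<open>n = 2\<close> the alternating
  sum in \<open>\<psi>\<close> is one such difference, with \<open>g = g\<^sub>2\<close>, so \<open>f \<circ> \<psi> \<circ> \<gamma>\<close> becomes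
  \<open>f (m\<^sub>1 - m\<^sub>2, \<delta> g\<^sub>2 m\<^sub>2)\<close>. For \<open>n = 3\<close> it is an iterated difference, at the last entry by \<open>g\<^sub>3\<close> and
  at the first entry by \<open>g\<^sub>2\<close>, which gives \<open>f (\<delta>' g\<^sub>2 (m\<^sub>1 - m\<^sub>2), m\<^sub>2 - m\<^sub>3, \<delta> g\<^sub>3 m\<^sub>3)\<close>.

  These formulas also yield the cocycle condition directly. Since \<open>\<phi>\<close> has central values, \<open>\<delta>\<close> and
  \<open>\<delta>'\<close> commute with the action of \<open>\<phi>(h)\<close>, and they intertwine the action of \<open>h\<close> with conjugation of
  the group component. Moreover \<open>(n, h)\<close> acts from below on \<open>(m, g)\<close> by
  \<open>((m - \<delta> h n) h, h\<^sup>-\<^sup>1 g h)\<close> (\<open>alex_under_affine\<close>). So in each face with the operations applied, the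
  arguments of \<open>f\<close> are those of the plain face up to factors \<open>h\<close> and \<open>\<phi>(h)\<close> and correction terms
  \<open>\<delta> h n\<close>, and invariance, multilinearity and absorption evaluate the difference of the two faces.
  Let \<open>D\<^sub>i\<close> be the value of the cochain on the \<open>i\<close>-th such difference, counted from 0. For \<open>n = 2\<close>,
  \<open>D\<^sub>0 = 0\<close> and \<open>D\<^sub>1 = D\<^sub>2 = f (m\<^sub>1 - m\<^sub>2, \<delta> g\<^sub>2 (\<delta> g\<^sub>3 m\<^sub>3))\<close>. For \<open>n = 3\<close>, put \<open>p = \<delta>' g\<^sub>2 (m\<^sub>1 - m\<^sub>2)\<close> and
  \<open>e = \<delta> g\<^sub>4 m\<^sub>4\<close>; then \<open>D\<^sub>0 = 0\<close>, \<open>D\<^sub>1 = f (\<delta>' g\<^sub>3 p, m\<^sub>3 - m\<^sub>4, e)\<close>, \<open>D\<^sub>3 = f (p, m\<^sub>2 - m\<^sub>3, \<delta> g\<^sub>3 e)\<close> and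
  \<open>D\<^sub>2 = D\<^sub>1 + D\<^sub>3\<close>. Either way the alternating sum \<open>D\<^sub>0 - D\<^sub>1 + D\<^sub>2 - \<dots>\<close> vanishes.
\<close>

section \<open>Differences in abelian groups and multilinear maps\<close>

lemma (in abelian_group) diff_add_cancel_right:
  assumes "x \<in> carrier G" "y \<in> carrier G"
  shows "(x \<oplus> y) \<ominus> y = x" "(x \<ominus> y) \<oplus> y = x"
  using assms by (simp_all add: minus_eq a_assoc r_neg l_neg)

lemma (in abelian_group) diff_diff_cancel:
  "x \<in> carrier G \<Longrightarrow> y \<in> carrier G \<Longrightarrow> x \<ominus> (x \<ominus> y) = y"
  by (simp add: minus_eq minus_add a_assoc[symmetric] r_neg)

lemma (in abelian_group) diff_self: "x \<in> carrier G \<Longrightarrow> x \<ominus> x = \<zero>"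
  by (simp add: minus_eq r_neg)

lemma (in abelian_group) diff_add_add:
  assumes "x \<in> carrier G" "y \<in> carrier G" "z \<in> carrier G" "t \<in> carrier G"
  shows "(x \<oplus> y) \<ominus> (z \<oplus> t) = (x \<ominus> z) \<oplus> (y \<ominus> t)"
  using assms by (simp add: minus_eq minus_add a_ac)

lemma hom_free_Abelian_group_diff:
  assumes "abelian_group A" and h: "h \<in> hom (free_Abelian_group S) (add_monoid A)"
    and "a \<in> carrier (free_Abelian_group S)" "b \<in> carrier (free_Abelian_group S)"
  shows "h (a - b) = h a \<ominus>\<^bsub>A\<^esub> h b"
proof -
  interpret A: abelian_group A by fact
  interpret h: group_hom "free_Abelian_group S" "add_monoid A" h
    by (intro group_hom.intro group_hom_axioms.intro A.a_group h) simp
  have d: "a - b \<in> carrier (free_Abelian_group S)"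
    using assms(3,4) keys_diff[of a b] by auto
  have "h a = h (a - b) \<oplus>\<^bsub>A\<^esub> h b"
    using h.hom_mult[OF d assms(4)] by simp
  then show ?thesis
    using h.hom_closed[OF d] h.hom_closed[OF assms(4)]
    by (simp add: A.diff_add_cancel_right)
qed

lemma multilinear_map_add:
  assumes "multilinear_map n M A f" "xs @ x # ys \<in> tuples n (carrier M)" "y \<in> carrier M"
  shows "f (xs @ (x \<oplus>\<^bsub>M\<^esub> y) # ys) = f (xs @ x # ys) \<oplus>\<^bsub>A\<^esub> f (xs @ y # ys)"
proof -
  have "length xs < n" "x \<in> carrier M"
    using assms(2) by (auto simp: tuples_def)
  with assms show ?thesis
    unfolding multilinear_map_def by (metis list_update_length)
qed

lemma multilinear_map_closed:
  assumes "multilinear_map n M A f" "xs \<in> tuples n (carrier M)"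
  shows "f xs \<in> carrier A"
  using assms by (simp add: multilinear_map_def)

lemma multilinear_map_diff:
  assumes "abelian_group M" "abelian_group A" and f: "multilinear_map n M A f"
    and xs: "xs @ x # ys \<in> tuples n (carrier M)" and y: "y \<in> carrier M"
  shows "f (xs @ (x \<ominus>\<^bsub>M\<^esub> y) # ys) = f (xs @ x # ys) \<ominus>\<^bsub>A\<^esub> f (xs @ y # ys)"
proof -
  interpret M: abelian_group M by fact
  interpret A: abelian_group A by fact
  have x: "x \<in> carrier M"
    using xs by (auto simp: tuples_def)
  have t: "xs @ (x \<ominus>\<^bsub>M\<^esub> y) # ys \<in> tuples n (carrier M)" "xs @ y # ys \<in> tuples n (carrier M)"
    using xs x y by (auto simp: tuples_def)
  have "x = (x \<ominus>\<^bsub>M\<^esub> y) \<oplus>\<^bsub>M\<^esub> y"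
    using x y by (simp add: M.diff_add_cancel_right)
  then have "f (xs @ x # ys) = f (xs @ (x \<ominus>\<^bsub>M\<^esub> y) # ys) \<oplus>\<^bsub>A\<^esub> f (xs @ y # ys)"
    using multilinear_map_add[OF f t(1) y] by simp
  then show ?thesis
    using multilinear_map_closed[OF f t(1)] multilinear_map_closed[OF f t(2)]
    by (simp add: A.diff_add_cancel_right)
qed

section \<open>The birack boundary on generators\<close>

text \<open>
  The \<open>i\<close>-th summand of the birack boundary without its sign. The two faces are kept together because
  most terms cancel between their values under the cochains considered here.
\<close>

definition face_difference ::
    "('x \<Rightarrow> 'x \<Rightarrow> 'x) \<Rightarrow> ('x \<Rightarrow> 'x \<Rightarrow> 'x) \<Rightarrow> nat \<Rightarrow> 'x list \<Rightarrow> ('x list \<Rightarrow>\<^sub>0 int)" where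
  "face_difference us os i xs =
     frag_of (take i xs @ drop (Suc i) xs)
     - frag_of (map (\<lambda>x. us x (xs ! i)) (take i xs) @ map (\<lambda>x. os x (xs ! i)) (drop (Suc i) xs))"

lemma face_tuples:
  assumes xs: "xs \<in> tuples (Suc n) X" and "i \<le> n"
    and us: "\<And>x y. x \<in> X \<Longrightarrow> y \<in> X \<Longrightarrow> us x y \<in> X" and os: "\<And>x y. x \<in> X \<Longrightarrow> y \<in> X \<Longrightarrow> os x y \<in> X"
  shows "take i xs @ drop (Suc i) xs \<in> tuples n X"
    and "map (\<lambda>x. us x (xs ! i)) (take i xs) @ map (\<lambda>x. os x (xs ! i)) (drop (Suc i) xs) \<in> tuples n X"
proof -
  have x: "xs ! i \<in> X"
    using assms by (auto simp: tuples_def)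
  have "set (take i xs) \<subseteq> X" "set (drop (Suc i) xs) \<subseteq> X"
    using xs set_take_subset[of i xs] set_drop_subset[of "Suc i" xs] by (auto simp: tuples_def)
  with assms(1,2) x us os show "take i xs @ drop (Suc i) xs \<in> tuples n X"
    and "map (\<lambda>x. us x (xs ! i)) (take i xs) @ map (\<lambda>x. os x (xs ! i)) (drop (Suc i) xs) \<in> tuples n X"
    by (auto simp: tuples_def)
qed

lemma face_difference_closed:
  assumes "xs \<in> tuples (Suc n) X" "i \<le> n"
    and "\<And>x y. x \<in> X \<Longrightarrow> y \<in> X \<Longrightarrow> us x y \<in> X" "\<And>x y. x \<in> X \<Longrightarrow> y \<in> X \<Longrightarrow> os x y \<in> X"
  shows "face_difference us os i xs \<in> carrier (free_Abelian_group (tuples n X))"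
  unfolding face_difference_def carrier_free_Abelian_group_iff
  using face_tuples[of xs n X i us os] assms
  by (intro order_trans[OF keys_diff]) simp

lemma birack_cocycleI:
  assumes "abelian_group A" "n \<ge> 1"
    and h: "h \<in> hom (birack_chains n X) (add_monoid A)"
    and us: "\<And>x y. x \<in> X \<Longrightarrow> y \<in> X \<Longrightarrow> us x y \<in> X" and os: "\<And>x y. x \<in> X \<Longrightarrow> y \<in> X \<Longrightarrow> os x y \<in> X"
    and generators: "\<And>xs. xs \<in> tuples (Suc n) X \<Longrightarrow>
      h (\<Sum>i<Suc n. frag_cmul ((-1) ^ i) (face_difference us os i xs)) = \<zero>\<^bsub>A\<^esub>"
  shows "birack_cocycle us os n X A h"
proof -
  interpret A: abelian_group A by fact
  let ?D = "birack_boundary us os (Suc n)"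
  let ?F = "\<lambda>xs. \<Sum>i<Suc n. frag_cmul ((-1) ^ i) (face_difference us os i xs)"
  have chains: "birack_chains n X = free_Abelian_group (tuples n X)"
    "birack_chains (Suc n) X = free_Abelian_group (tuples (Suc n) X)"
    using \<open>n \<ge> 1\<close> by (simp_all add: birack_chains_def)
  have D: "?D = frag_extend ?F"
    using \<open>n \<ge> 1\<close> by (simp add: birack_boundary_def face_difference_def)
  have F: "?F xs \<in> carrier (free_Abelian_group (tuples n X))" if "xs \<in> tuples (Suc n) X" for xs
  proof (rule sum_closed_free_Abelian_group)
    fix i assume "i \<in> {..<Suc n}"
    then have "face_difference us os i xs \<in> carrier (free_Abelian_group (tuples n X))"
      using that us os by (intro face_difference_closed) auto
    then show "frag_cmul ((-1) ^ i) (face_difference us os i xs) \<in> carrier (free_Abelian_group (tuples n X))"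
      using keys_cmul by fastforce
  qed
  have "?D \<in> hom (birack_chains (Suc n) X) (birack_chains n X)"
    unfolding D chains using F by (intro frag_extend_hom) simp
  then have hD: "h \<circ> ?D \<in> hom (free_Abelian_group (tuples (Suc n) X)) (add_monoid A)"
    using Group.hom_compose[OF _ h] by (simp add: chains)
  interpret hD: group_hom "free_Abelian_group (tuples (Suc n) X)" "add_monoid A" "h \<circ> ?D"
    by (intro group_hom.intro group_hom_axioms.intro A.a_group hD) simp
  have "(h \<circ> ?D) c = \<zero>\<^bsub>A\<^esub>" if c: "c \<in> carrier (free_Abelian_group (tuples (Suc n) X))" for c
    using c[unfolded carrier_free_Abelian_group_iff]
  proof (rule free_Abelian_group_induct)
    show "(h \<circ> ?D) 0 = \<zero>\<^bsub>A\<^esub>"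
      using hD.hom_one by simp
  next
    fix x y
    assume "Poly_Mapping.keys x \<subseteq> tuples (Suc n) X" "Poly_Mapping.keys y \<subseteq> tuples (Suc n) X"
      "(h \<circ> ?D) x = \<zero>\<^bsub>A\<^esub>" "(h \<circ> ?D) y = \<zero>\<^bsub>A\<^esub>"
    then show "(h \<circ> ?D) (x - y) = \<zero>\<^bsub>A\<^esub>"
      using hom_free_Abelian_group_diff[OF assms(1) hD, of x y] by (simp add: A.minus_eq)
  next
    fix xs assume "xs \<in> tuples (Suc n) X"
    then show "(h \<circ> ?D) (frag_of xs) = \<zero>\<^bsub>A\<^esub>"
      using generators by (simp add: D)
  qed
  then show ?thesis
    using h by (simp add: birack_cocycle_def chains)
qed

lemma hom_face_difference:
  assumes "abelian_group A" and h: "h \<in> hom (free_Abelian_group (tuples n X)) (add_monoid A)"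
    and "xs \<in> tuples (Suc n) X" "i \<le> n"
    and "\<And>x y. x \<in> X \<Longrightarrow> y \<in> X \<Longrightarrow> us x y \<in> X" "\<And>x y. x \<in> X \<Longrightarrow> y \<in> X \<Longrightarrow> os x y \<in> X"
  shows "h (face_difference us os i xs) = h (frag_of (take i xs @ drop (Suc i) xs))
    \<ominus>\<^bsub>A\<^esub> h (frag_of (map (\<lambda>x. us x (xs ! i)) (take i xs) @ map (\<lambda>x. os x (xs ! i)) (drop (Suc i) xs)))"
  unfolding face_difference_def
  using face_tuples[of xs n X i us os] assms
  by (intro hom_free_Abelian_group_diff) simp_all

section \<open>The action of the group and its defects\<close>

locale alexander_data =
  G: group G + M: right_module "group_ring G" M act + A: abelian_group A
  for G :: "('g, 'b) monoid_scheme" (structure)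
    and M :: "('m, 'c) ring_scheme" (structure)
    and A :: "('a, 'd) ring_scheme" (structure)
    and act :: "'m \<Rightarrow> ('g \<Rightarrow>\<^sub>0 int) \<Rightarrow> 'm" +
  fixes \<phi> :: "'g \<Rightarrow> 'g"
  assumes phi_hom: "\<phi> \<in> hom G (G\<lparr>carrier := center G\<rparr>)"
begin

abbreviation gact (infixl "\<triangleleft>" 75) where
  "m \<triangleleft> g \<equiv> act m (frag_of g)"

lemma phi_closed [simp, intro]: "g \<in> carrier G \<Longrightarrow> \<phi> g \<in> carrier G"
  using hom_in_carrier[OF phi_hom] by (simp add: center_def)

lemma phi_central: "g \<in> carrier G \<Longrightarrow> h \<in> carrier G \<Longrightarrow> \<phi> g \<otimes> h = h \<otimes> \<phi> g"
  using hom_in_carrier[OF phi_hom] by (simp add: center_def)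

lemma phi_mult: "g \<in> carrier G \<Longrightarrow> h \<in> carrier G \<Longrightarrow> \<phi> (g \<otimes> h) = \<phi> g \<otimes> \<phi> h"
  using hom_mult[OF phi_hom] by simp

lemma phi_one: "\<phi> \<one> = \<one>"
  using phi_mult[of \<one> \<one>] by (metis G.l_cancel_one' G.one_closed G.r_one phi_closed)

lemma phi_conj:
  assumes "g \<in> carrier G" "h \<in> carrier G"
  shows "\<phi> (inv h \<otimes> g \<otimes> h) = \<phi> g"
proof -
  have "\<phi> (inv h \<otimes> g \<otimes> h) = \<phi> (inv h) \<otimes> \<phi> g \<otimes> \<phi> h"
    using assms by (simp add: phi_mult)
  also have "\<dots> = \<phi> g \<otimes> (\<phi> (inv h) \<otimes> \<phi> h)"
    using assms by (simp add: phi_central[symmetric, of g] G.m_assoc)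
  also have "\<phi> (inv h) \<otimes> \<phi> h = \<one>"
    using assms phi_mult[of "inv h" h] by (simp add: phi_one)
  finally show ?thesis
    using assms by simp
qed

lemma frag_of_closed [simp, intro]: "g \<in> carrier G \<Longrightarrow> frag_of g \<in> carrier (group_ring G)"
  by (simp add: group_ring_def)

lemma gact_closed [simp, intro]: "m \<in> carrier M \<Longrightarrow> g \<in> carrier G \<Longrightarrow> m \<triangleleft> g \<in> carrier M"
  by simp

lemma gact_gact:
  "m \<in> carrier M \<Longrightarrow> g \<in> carrier G \<Longrightarrow> h \<in> carrier G \<Longrightarrow> m \<triangleleft> g \<triangleleft> h = m \<triangleleft> (g \<otimes> h)"
  using M.act_mult[of m "frag_of g" "frag_of h"] by (simp add: group_ring_def)

lemma gact_one [simp]: "m \<in> carrier M \<Longrightarrow> m \<triangleleft> \<one> = m"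
  using M.act_one[of m] by (simp add: group_ring_def)

lemma gact_add:
  "m \<in> carrier M \<Longrightarrow> n \<in> carrier M \<Longrightarrow> g \<in> carrier G \<Longrightarrow>
    (m \<oplus>\<^bsub>M\<^esub> n) \<triangleleft> g = m \<triangleleft> g \<oplus>\<^bsub>M\<^esub> n \<triangleleft> g"
  by (intro M.act_add_left) auto

lemma gact_diff:
  assumes "m \<in> carrier M" "n \<in> carrier M" "g \<in> carrier G"
  shows "(m \<ominus>\<^bsub>M\<^esub> n) \<triangleleft> g = m \<triangleleft> g \<ominus>\<^bsub>M\<^esub> n \<triangleleft> g"
  using assms gact_add[of "m \<ominus>\<^bsub>M\<^esub> n" n g] by (simp add: M.diff_add_cancel_right)

lemma gact_minus:
  assumes "m \<in> carrier M" "g \<in> carrier G"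
  shows "(\<ominus>\<^bsub>M\<^esub> m) \<triangleleft> g = \<ominus>\<^bsub>M\<^esub> (m \<triangleleft> g)"
proof -
  have "(\<ominus>\<^bsub>M\<^esub> m) \<triangleleft> g \<oplus>\<^bsub>M\<^esub> m \<triangleleft> g = (m \<ominus>\<^bsub>M\<^esub> m) \<triangleleft> g"
    using assms by (simp add: M.minus_eq M.a_comm flip: gact_add)
  also have "\<dots> = \<zero>\<^bsub>M\<^esub>"
    using assms by (subst gact_diff) (simp_all add: M.diff_self)
  finally show ?thesis
    using assms by (simp add: M.minus_equality)
qed

lemma act_frag_of_diff:
  assumes "m \<in> carrier M" "g \<in> carrier G" "h \<in> carrier G"
  shows "act m (frag_of g - frag_of h) = m \<triangleleft> g \<ominus>\<^bsub>M\<^esub> m \<triangleleft> h"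
proof -
  let ?d = "frag_of g - frag_of h"
  have d: "?d \<in> carrier (group_ring G)"
    using assms(2,3) keys_diff[of "frag_of g" "frag_of h"] by (auto simp: group_ring_def)
  have "m \<triangleleft> g = act m (?d \<oplus>\<^bsub>group_ring G\<^esub> frag_of h)"
    by (simp add: group_ring_def)
  also have "\<dots> = act m ?d \<oplus>\<^bsub>M\<^esub> m \<triangleleft> h"
    using assms d by (intro M.act_add_right) auto
  finally show ?thesis
    using assms d by (simp add: M.diff_add_cancel_right)
qed

text \<open>
  Right multiplication by \<open>1 - e\<close> in the group ring.
\<close>

definition defect :: "'g \<Rightarrow> 'm \<Rightarrow> 'm" where
  "defect e m = m \<ominus>\<^bsub>M\<^esub> m \<triangleleft> e"

lemma defect_closed [simp, intro]:
  "e \<in> carrier G \<Longrightarrow> m \<in> carrier M \<Longrightarrow> defect e m \<in> carrier M"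
  by (simp add: defect_def)

lemma defect_diff:
  assumes "e \<in> carrier G" "m \<in> carrier M" "n \<in> carrier M"
  shows "defect e (m \<ominus>\<^bsub>M\<^esub> n) = defect e m \<ominus>\<^bsub>M\<^esub> defect e n"
  using assms by (simp add: defect_def gact_add gact_minus M.minus_eq M.minus_add M.a_ac)

text \<open>
  Multiplication by \<open>h\<close> turns \<open>1 - e\<close> into \<open>1 - h\<^sup>-\<^sup>1 e h\<close>, because \<open>h (h\<^sup>-\<^sup>1 e h) = e h\<close>. The lower
  operation conjugates the group component, so this is the form in which defects occur in the faces.
\<close>

lemma defect_conj:
  assumes "e \<in> carrier G" "h \<in> carrier G" "m \<in> carrier M"
  shows "defect (inv h \<otimes> e \<otimes> h) (m \<triangleleft> h) = defect e m \<triangleleft> h"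
proof -
  have "h \<otimes> (inv h \<otimes> e \<otimes> h) = e \<otimes> h"
    using assms by (simp add: G.m_assoc[symmetric])
  then show ?thesis
    using assms by (simp add: defect_def gact_diff gact_gact)
qed

lemma defect_central:
  assumes "e \<in> carrier G" "h \<in> carrier G" "m \<in> carrier M"
  shows "defect e (m \<triangleleft> \<phi> h) = defect e m \<triangleleft> \<phi> h"
  using assms by (simp add: defect_def gact_diff gact_gact phi_central)

text \<open>
  In the formulas for the cochains, \<open>\<delta>\<close> acts on the last argument of \<open>f\<close> and \<open>\<delta>'\<close> on the first.
\<close>

definition \<delta> :: "'g \<Rightarrow> 'm \<Rightarrow> 'm" where
  "\<delta> g = defect (\<phi> g \<otimes> inv g)"

definition \<delta>' :: "'g \<Rightarrow> 'm \<Rightarrow> 'm" where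
  "\<delta>' g = defect (inv (\<phi> g) \<otimes> g)"

lemma delta_closed [simp, intro]: "g \<in> carrier G \<Longrightarrow> m \<in> carrier M \<Longrightarrow> \<delta> g m \<in> carrier M"
  and delta'_closed [simp, intro]: "g \<in> carrier G \<Longrightarrow> m \<in> carrier M \<Longrightarrow> \<delta>' g m \<in> carrier M"
  by (simp_all add: \<delta>_def \<delta>'_def)

lemma delta_diff:
  "g \<in> carrier G \<Longrightarrow> m \<in> carrier M \<Longrightarrow> n \<in> carrier M \<Longrightarrow>
    \<delta> g (m \<ominus>\<^bsub>M\<^esub> n) = \<delta> g m \<ominus>\<^bsub>M\<^esub> \<delta> g n"
  and delta'_diff:
  "g \<in> carrier G \<Longrightarrow> m \<in> carrier M \<Longrightarrow> n \<in> carrier M \<Longrightarrow>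
    \<delta>' g (m \<ominus>\<^bsub>M\<^esub> n) = \<delta>' g m \<ominus>\<^bsub>M\<^esub> \<delta>' g n"
  by (simp_all add: \<delta>_def \<delta>'_def defect_diff)

lemma delta'_add:
  assumes "g \<in> carrier G" "m \<in> carrier M" "n \<in> carrier M"
  shows "\<delta>' g (m \<oplus>\<^bsub>M\<^esub> n) = \<delta>' g m \<oplus>\<^bsub>M\<^esub> \<delta>' g n"
  using assms by (simp add: \<delta>'_def defect_def gact_add M.diff_add_add)

lemma delta_central:
  "g \<in> carrier G \<Longrightarrow> h \<in> carrier G \<Longrightarrow> m \<in> carrier M \<Longrightarrow> \<delta> g (m \<triangleleft> \<phi> h) = \<delta> g m \<triangleleft> \<phi> h"
  and delta'_central:
  "g \<in> carrier G \<Longrightarrow> h \<in> carrier G \<Longrightarrow> m \<in> carrier M \<Longrightarrow> \<delta>' g (m \<triangleleft> \<phi> h) = \<delta>' g m \<triangleleft> \<phi> h"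
  by (simp_all add: \<delta>_def \<delta>'_def defect_central)

text \<open>
  Centrality makes \<open>\<phi>\<close> invariant under conjugation, so \<open>\<phi>(g) g\<^sup>-\<^sup>1\<close> is conjugated along with \<open>g\<close>; the
  same applies to \<open>\<phi>(g)\<^sup>-\<^sup>1 g\<close> further below.
\<close>

lemma delta_conj:
  assumes "g \<in> carrier G" "h \<in> carrier G" "m \<in> carrier M"
  shows "\<delta> (inv h \<otimes> g \<otimes> h) (m \<triangleleft> h) = \<delta> g m \<triangleleft> h"
proof -
  have "\<phi> g \<otimes> inv (inv h \<otimes> g \<otimes> h) = inv h \<otimes> (\<phi> g \<otimes> inv g) \<otimes> h"
    using assms by (simp add: G.inv_mult_group G.m_assoc phi_central)
  then show ?thesis
    using assms by (simp add: \<delta>_def phi_conj defect_conj)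
qed

lemma inv_phi_central:
  assumes "g \<in> carrier G" "h \<in> carrier G"
  shows "inv (\<phi> g) \<otimes> h = h \<otimes> inv (\<phi> g)"
  using assms phi_central[of g "inv h"]
  by (metis G.inv_closed G.inv_inv G.inv_mult_group phi_closed)

lemma delta'_conj:
  assumes "g \<in> carrier G" "h \<in> carrier G" "m \<in> carrier M"
  shows "\<delta>' (inv h \<otimes> g \<otimes> h) (m \<triangleleft> h) = \<delta>' g m \<triangleleft> h"
proof -
  have "inv (\<phi> g) \<otimes> (inv h \<otimes> g \<otimes> h) = inv h \<otimes> (inv (\<phi> g) \<otimes> g) \<otimes> h"
    using assms inv_phi_central[of g "inv h"] by (simp add: G.m_assoc[symmetric])
  then show ?thesis
    using assms by (simp add: \<delta>'_def phi_conj defect_conj)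
qed

lemma delta_gact:
  "g \<in> carrier G \<Longrightarrow> m \<in> carrier M \<Longrightarrow> \<delta> g m \<triangleleft> g = m \<triangleleft> g \<ominus>\<^bsub>M\<^esub> m \<triangleleft> \<phi> g"
  by (simp add: \<delta>_def defect_def gact_diff gact_gact G.m_assoc)

text \<open>
  Pulling \<open>h\<close> out of \<open>m h + n (\<phi>(h) - h)\<close> leaves \<open>m - \<delta> h n\<close>. In this form the correction term cancels
  from the difference of two elements acted on by the same \<open>(n, h)\<close>.
\<close>

lemma alex_under_affine:
  assumes "m \<in> carrier M" "n \<in> carrier M" "g \<in> carrier G" "h \<in> carrier G"
  shows "alex_under G M act \<phi> (m, g) (n, h) = ((m \<ominus>\<^bsub>M\<^esub> \<delta> h n) \<triangleleft> h, inv h \<otimes> g \<otimes> h)"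
  using assms
  by (simp add: act_frag_of_diff gact_add gact_minus delta_gact M.minus_eq M.minus_add M.a_ac)

lemma diff_split:
  assumes "m \<in> carrier M" "n \<in> carrier M" "p \<in> carrier M"
  shows "m \<ominus>\<^bsub>M\<^esub> p = (m \<ominus>\<^bsub>M\<^esub> n) \<oplus>\<^bsub>M\<^esub> (n \<ominus>\<^bsub>M\<^esub> p)"
  using assms by (simp add: M.minus_eq M.a_assoc M.r_neg1)

text \<open>
  The next two lemmas are the differences of consecutive module components of a face. Here the
  deleted entry \<open>(n, h)\<close> sits between \<open>m\<close>, which it acts on from below, and \<open>p\<close>, which it acts on
  from above: the difference passes through \<open>n\<close>, with a different multiplier on either side.
\<close>

lemma under_minus_over:
  assumes "m \<in> carrier M" "n \<in> carrier M" "p \<in> carrier M" "h \<in> carrier G"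
  shows "(m \<ominus>\<^bsub>M\<^esub> \<delta> h n) \<triangleleft> h \<ominus>\<^bsub>M\<^esub> p \<triangleleft> \<phi> h
    = (m \<ominus>\<^bsub>M\<^esub> n) \<triangleleft> h \<oplus>\<^bsub>M\<^esub> (n \<ominus>\<^bsub>M\<^esub> p) \<triangleleft> \<phi> h"
  using assms
  by (simp add: gact_add gact_minus delta_gact M.minus_eq M.minus_add M.a_ac)

lemma under_minus_under:
  assumes "m \<in> carrier M" "n \<in> carrier M" "p \<in> carrier M" "h \<in> carrier G"
  shows "(m \<ominus>\<^bsub>M\<^esub> p) \<triangleleft> h \<ominus>\<^bsub>M\<^esub> (n \<ominus>\<^bsub>M\<^esub> p) \<triangleleft> h = (m \<ominus>\<^bsub>M\<^esub> n) \<triangleleft> h"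
proof -
  have "(m \<ominus>\<^bsub>M\<^esub> p) \<ominus>\<^bsub>M\<^esub> (n \<ominus>\<^bsub>M\<^esub> p) = m \<ominus>\<^bsub>M\<^esub> n"
    using assms diff_split[of m n p] by (simp add: M.diff_add_cancel_right)
  then show ?thesis
    using assms by (simp flip: gact_diff)
qed

section \<open>Absorbing twists by invariance\<close>

lemma invariant_mapD:
  "invariant_map G M act n f \<Longrightarrow> xs \<in> tuples n (carrier M) \<Longrightarrow> g \<in> carrier G \<Longrightarrow>
    f (map (\<lambda>m. m \<triangleleft> g) xs) = f xs"
  by (simp add: invariant_map_def)

text \<open>
  By invariance under \<open>g\<close>, the second value equals \<open>f\<close> at \<open>ms\<close> with last entry \<open>c \<phi>(g) g\<^sup>-\<^sup>1\<close>, which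
  differs from the first tuple in the last entry only.
\<close>

lemma twist_absorbed_last:
  assumes f: "multilinear_map n M A f" "invariant_map G M act n f"
    and t: "ms @ [c] \<in> tuples n (carrier M)" and g: "g \<in> carrier G"
  shows "f (ms @ [c]) \<ominus>\<^bsub>A\<^esub> f (map (\<lambda>m. m \<triangleleft> g) ms @ [c \<triangleleft> \<phi> g]) = f (ms @ [\<delta> g c])"
proof -
  let ?e = "\<phi> g \<otimes> inv g"
  have c: "c \<in> carrier M"
    using t by (simp add: tuples_def)
  have "ms @ [c \<triangleleft> ?e] \<in> tuples n (carrier M)"
    using t g by (simp add: tuples_def)
  then have "f (map (\<lambda>m. m \<triangleleft> g) (ms @ [c \<triangleleft> ?e])) = f (ms @ [c \<triangleleft> ?e])"
    using f g by (intro invariant_mapD)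
  then have "f (map (\<lambda>m. m \<triangleleft> g) ms @ [c \<triangleleft> \<phi> g]) = f (ms @ [c \<triangleleft> ?e])"
    using c g by (simp add: gact_gact G.m_assoc)
  then show ?thesis
    using multilinear_map_diff[OF M.abelian_group_axioms A.abelian_group_axioms f(1) t] c g
    by (simp add: \<delta>_def defect_def)
qed

text \<open>
  The mirror image: invariance under \<open>\<phi>(g)\<close> brings the second tuple back to \<open>ms\<close> with first entry
  \<open>a \<phi>(g)\<^sup>-\<^sup>1 g\<close>.
\<close>

lemma twist_absorbed_first:
  assumes f: "multilinear_map n M A f" "invariant_map G M act n f"
    and t: "a # ms \<in> tuples n (carrier M)" and g: "g \<in> carrier G"
  shows "f (a # ms) \<ominus>\<^bsub>A\<^esub> f (a \<triangleleft> g # map (\<lambda>m. m \<triangleleft> \<phi> g) ms) = f (\<delta>' g a # ms)"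
proof -
  let ?e = "inv (\<phi> g) \<otimes> g"
  have a: "a \<in> carrier M"
    using t by (simp add: tuples_def)
  have "?e \<otimes> \<phi> g = g"
    using g by (simp add: inv_phi_central G.m_assoc)
  moreover have "a \<triangleleft> ?e # ms \<in> tuples n (carrier M)"
    using t g by (simp add: tuples_def)
  then have "f (map (\<lambda>m. m \<triangleleft> \<phi> g) (a \<triangleleft> ?e # ms)) = f (a \<triangleleft> ?e # ms)"
    using f g by (intro invariant_mapD) auto
  ultimately have "f (a \<triangleleft> g # map (\<lambda>m. m \<triangleleft> \<phi> g) ms) = f (a \<triangleleft> ?e # ms)"
    using a g by (simp add: gact_gact)
  then show ?thesis
    using multilinear_map_diff[OF M.abelian_group_axioms A.abelian_group_axioms f(1), of "[]" a ms] t a g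
    by (simp add: \<delta>'_def defect_def)
qed

section \<open>The cochains on generators\<close>

lemma birack_cochain_hom:
  assumes "multilinear_map n M A f" "invariant_map G M act n f"
  shows "birack_cochain G M act \<phi> A n f \<in> hom (birack_chains n (alex_carrier G M)) (add_monoid A)"
proof -
  have "\<phi> \<in> carrier G \<rightarrow> carrier G"
    by auto
  then show ?thesis
    unfolding birack_cochain_def o_assoc[symmetric]
    using gamma_map_hom[OF M.abelian_group_axioms, of n G]
      psi_map_hom[OF G.group_axioms M.right_module_axioms, of \<phi> n]
      gp_induced_hom[OF G.group_axioms M.right_module_axioms A.abelian_group_axioms assms]
    by (intro Group.hom_compose)
qed

lemma birack_cochain_frag_of:
  assumes f: "multilinear_map n M A f" "invariant_map G M act n f" and n: "n \<ge> 1"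
    and xs: "xs \<in> tuples n (alex_carrier G M)"
  defines "ms \<equiv> map (\<lambda>i. if Suc i < n then fst (xs ! i) \<ominus>\<^bsub>M\<^esub> fst (xs ! Suc i) else fst (xs ! i)) [0..<n]"
  shows "birack_cochain G M act \<phi> A n f (frag_of xs) =
    lin_extend A f (\<Sum>ks \<in> psi_indices n. frag_cmul ((-1) ^ sum_list ks)
      (frag_of (map (\<lambda>i. (ms ! i) \<triangleleft> psi_coeff G \<phi> (map snd xs) ks (Suc i)) [0..<n])))"
proof -
  have entries: "xs ! i \<in> carrier M \<times> carrier G" if "i < n" for i
    using xs that nth_mem[of i xs] by (auto simp: tuples_def alex_carrier_def)
  have gs: "set (map snd xs) \<subseteq> carrier G"
    using xs by (auto simp: tuples_def alex_carrier_def)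
  have "ms ! i \<in> carrier M" if "i < n" for i
    using entries[OF that] entries[of "Suc i"] that
    by (auto simp: ms_def mem_Times_iff)
  moreover have "psi_coeff G \<phi> (map snd xs) ks i \<in> carrier G" for ks i
    by (intro psi_coeff_closed G.group_axioms gs) auto
  ultimately have "map (\<lambda>i. (ms ! i) \<triangleleft> psi_coeff G \<phi> (map snd xs) ks (Suc i)) [0..<n]
      \<in> tuples n (carrier M)" for ks
    by (auto simp: tuples_def)
  then have "(\<Sum>ks \<in> psi_indices n. frag_cmul ((-1) ^ sum_list ks)
      (frag_of (map (\<lambda>i. (ms ! i) \<triangleleft> psi_coeff G \<phi> (map snd xs) ks (Suc i)) [0..<n])))
      \<in> carrier (gp_free n M)"
    using n unfolding gp_free_def by (intro sum_closed_free_Abelian_group) (simp add: subset_iff)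
  from gp_induced_class[OF G.group_axioms M.right_module_axioms A.abelian_group_axioms f this]
  show ?thesis
    by (simp add: birack_cochain_def gamma_map_def psi_map_def ms_def)
qed

lemma lin_extend_diff:
  assumes "multilinear_map n M A f" "n \<ge> 1" "a \<in> carrier (gp_free n M)" "b \<in> carrier (gp_free n M)"
  shows "lin_extend A f (a - b) = lin_extend A f a \<ominus>\<^bsub>A\<^esub> lin_extend A f b"
  using assms unfolding gp_free_def
  by (intro hom_free_Abelian_group_diff[OF A.abelian_group_axioms
        lin_extend_hom[OF A.abelian_group_axioms]])
    (auto simp: multilinear_map_closed)

lemma lin_extend_frag_of_diff:
  assumes "multilinear_map n M A f" "n \<ge> 1" "xs \<in> tuples n (carrier M)" "ys \<in> tuples n (carrier M)"
  shows "lin_extend A f (frag_of xs - frag_of ys) = f xs \<ominus>\<^bsub>A\<^esub> f ys"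
  using assms lin_extend_diff[OF assms(1,2), of "frag_of xs" "frag_of ys"]
  by (simp add: gp_free_def lin_extend_frag_of A.abelian_group_axioms multilinear_map_closed)

lemma psi_indices_2: "psi_indices 2 = {[0, 0], [0, 1]}"
  by (auto simp: psi_indices_def tuples_def numeral_2_eq_2 length_Suc_conv)

lemma psi_indices_3: "psi_indices 3 = {[0, 0, 0], [0, 0, 1], [0, 1, 0], [0, 1, 1]}"
  by (auto simp: psi_indices_def tuples_def numeral_3_eq_3 length_Suc_conv)

text \<open>
  The index \<open>k = (0, 0)\<close> contributes \<open>(a, m\<^sub>2)\<close> with \<open>a = m\<^sub>1 - m\<^sub>2\<close>, and \<open>k = (0, 1)\<close> contributes
  \<open>-(a g\<^sub>2, m\<^sub>2 \<phi>(g\<^sub>2))\<close>: a twist at the last entry by \<open>g\<^sub>2\<close>.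
\<close>

lemma birack_cochain_2:
  assumes f: "multilinear_map 2 M A f" "invariant_map G M act 2 f"
    and x: "m1 \<in> carrier M" "m2 \<in> carrier M" "g1 \<in> carrier G" "g2 \<in> carrier G"
  shows "birack_cochain G M act \<phi> A 2 f (frag_of [(m1, g1), (m2, g2)]) = f [m1 \<ominus>\<^bsub>M\<^esub> m2, \<delta> g2 m2]"
proof -
  let ?a = "m1 \<ominus>\<^bsub>M\<^esub> m2"
  have "birack_cochain G M act \<phi> A 2 f (frag_of [(m1, g1), (m2, g2)])
      = lin_extend A f (frag_of [?a, m2] - frag_of [?a \<triangleleft> g2, m2 \<triangleleft> \<phi> g2])"
    using birack_cochain_frag_of[OF f, of "[(m1, g1), (m2, g2)]"] x
    by (simp add: tuples_def alex_carrier_def psi_indices_2[unfolded numeral_2_eq_2] psi_coeff_def list_prod_def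
        upt_rec[of _ 2] phi_one numeral_2_eq_2)
  also have "\<dots> = f [?a, m2] \<ominus>\<^bsub>A\<^esub> f [?a \<triangleleft> g2, m2 \<triangleleft> \<phi> g2]"
    using f x by (intro lin_extend_frag_of_diff[of 2]) (auto simp: tuples_def)
  also have "\<dots> = f [?a, \<delta> g2 m2]"
    using twist_absorbed_last[OF f, of "[?a]" m2 g2] x by (simp add: tuples_def)
  finally show ?thesis .
qed

text \<open>
  Grouped by \<open>k\<^sub>2\<close>, the four summands are two differences, each between a tuple and its twist at the last
  entry by \<open>g\<^sub>3\<close>. Absorbing both leaves the difference of a tuple and its twist at the first entry by \<open>g\<^sub>2\<close>.
\<close>

lemma birack_cochain_3:
  assumes f: "multilinear_map 3 M A f" "invariant_map G M act 3 f"
    and x: "m1 \<in> carrier M" "m2 \<in> carrier M" "m3 \<in> carrier M"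
      "g1 \<in> carrier G" "g2 \<in> carrier G" "g3 \<in> carrier G"
  shows "birack_cochain G M act \<phi> A 3 f (frag_of [(m1, g1), (m2, g2), (m3, g3)])
    = f [\<delta>' g2 (m1 \<ominus>\<^bsub>M\<^esub> m2), m2 \<ominus>\<^bsub>M\<^esub> m3, \<delta> g3 m3]"
proof -
  define a b where ab: "a = m1 \<ominus>\<^bsub>M\<^esub> m2" "b = m2 \<ominus>\<^bsub>M\<^esub> m3"
  have abc: "a \<in> carrier M" "b \<in> carrier M"
    using x by (simp_all add: ab)
  let ?p = "[a, b, m3]" and ?q = "[a \<triangleleft> g2, b \<triangleleft> \<phi> g2, m3 \<triangleleft> \<phi> g2]"
  let ?p' = "[a \<triangleleft> g3, b \<triangleleft> g3, m3 \<triangleleft> \<phi> g3]"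
  let ?q' = "[a \<triangleleft> g2 \<triangleleft> g3, b \<triangleleft> \<phi> g2 \<triangleleft> g3, m3 \<triangleleft> \<phi> g2 \<triangleleft> \<phi> g3]"
  have t: "?p \<in> tuples 3 (carrier M)" "?q \<in> tuples 3 (carrier M)"
    "?p' \<in> tuples 3 (carrier M)" "?q' \<in> tuples 3 (carrier M)"
    using x abc by (simp_all add: tuples_def)
  have "birack_cochain G M act \<phi> A 3 f (frag_of [(m1, g1), (m2, g2), (m3, g3)])
      = lin_extend A f ((frag_of ?p - frag_of ?p') - (frag_of ?q - frag_of ?q'))"
    using birack_cochain_frag_of[OF f, of "[(m1, g1), (m2, g2), (m3, g3)]"] x abc
    by (simp add: tuples_def alex_carrier_def psi_indices_3[unfolded numeral_3_eq_3] psi_coeff_def list_prod_def ab[symmetric]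
        upt_rec[of _ 3] phi_one phi_mult gact_gact numeral_3_eq_3 algebra_simps)
  also have "\<dots> = (f ?p \<ominus>\<^bsub>A\<^esub> f ?p') \<ominus>\<^bsub>A\<^esub> (f ?q \<ominus>\<^bsub>A\<^esub> f ?q')"
  proof -
    have "frag_of r - frag_of s \<in> carrier (gp_free 3 M)"
      if "r \<in> tuples 3 (carrier M)" "s \<in> tuples 3 (carrier M)" for r s
      using that keys_diff[of "frag_of r" "frag_of s"] by (auto simp: gp_free_def)
    then show ?thesis
      using t f by (simp add: lin_extend_diff[of 3] lin_extend_frag_of_diff[of 3])
  qed
  also have "f ?p \<ominus>\<^bsub>A\<^esub> f ?p' = f [a, b, \<delta> g3 m3]"
    using twist_absorbed_last[OF f, of "[a, b]" m3 g3] t x by simp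
  also have "f ?q \<ominus>\<^bsub>A\<^esub> f ?q' = f [a \<triangleleft> g2, b \<triangleleft> \<phi> g2, \<delta> g3 m3 \<triangleleft> \<phi> g2]"
    using twist_absorbed_last[OF f, of "[a \<triangleleft> g2, b \<triangleleft> \<phi> g2]" "m3 \<triangleleft> \<phi> g2" g3] t x
    by (simp add: delta_central)
  also have "f [a, b, \<delta> g3 m3] \<ominus>\<^bsub>A\<^esub> \<dots> = f [\<delta>' g2 a, b, \<delta> g3 m3]"
    using twist_absorbed_first[OF f, of a "[b, \<delta> g3 m3]" g2] x abc by (simp add: tuples_def)
  finally show ?thesis
    by (simp add: ab)
qed

section \<open>The cocycle condition\<close>

lemma alex_under_closed:
  assumes "x \<in> alex_carrier G M" "y \<in> alex_carrier G M"
  shows "alex_under G M act \<phi> x y \<in> alex_carrier G M"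
  using assms by (cases x; cases y) (simp add: alex_carrier_def alex_under_affine del: alex_under.simps)

lemma alex_over_closed:
  assumes "x \<in> alex_carrier G M" "y \<in> alex_carrier G M"
  shows "alex_over act \<phi> x y \<in> alex_carrier G M"
  using assms by (cases x; cases y) (simp add: alex_carrier_def)

lemma act_one_diff:
  assumes "m \<in> carrier M" "e \<in> carrier G"
  shows "act m (frag_of \<one> - frag_of e) = defect e m"
  using assms by (simp add: act_frag_of_diff defect_def)

text \<open>
  On a generator, the difference of faces at the first entry vanishes by invariance,
  because \<open>\<phi>(g\<^sub>1)\<close> acts on all remaining module components. The differences at the second and third
  entries are equal, and they carry opposite signs.
\<close>

lemma birack_cocycle_2:
  assumes f: "multilinear_map 2 M A f" "invariant_map G M act 2 f"
  shows "birack_cocycle (alex_under G M act \<phi>) (alex_over act \<phi>) 2 (alex_carrier G M) A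
    (birack_cochain G M act \<phi> A 2 f)"
proof (rule birack_cocycleI[OF A.abelian_group_axioms _ birack_cochain_hom[OF f]
      alex_under_closed alex_over_closed])
  let ?h = "birack_cochain G M act \<phi> A 2 f"
  let ?S = "tuples 2 (alex_carrier G M)"
  let ?F = "face_difference (alex_under G M act \<phi>) (alex_over act \<phi>)"
  have h: "?h \<in> hom (free_Abelian_group ?S) (add_monoid A)"
    using birack_cochain_hom[OF f] by (simp add: birack_chains_def)
  fix xs assume xs: "xs \<in> tuples (Suc 2) (alex_carrier G M)"
  then obtain m1 g1 m2 g2 m3 g3 where xs_eq: "xs = [(m1, g1), (m2, g2), (m3, g3)]"
    and m: "m1 \<in> carrier M" "m2 \<in> carrier M" "m3 \<in> carrier M"
    and g: "g1 \<in> carrier G" "g2 \<in> carrier G" "g3 \<in> carrier G"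
    by (auto simp: tuples_def alex_carrier_def length_Suc_conv numeral_2_eq_2)
  define a b e where abe: "a = m1 \<ominus>\<^bsub>M\<^esub> m2" "b = m2 \<ominus>\<^bsub>M\<^esub> m3" "e = \<delta> g3 m3"
  have abe_closed [simp]: "a \<in> carrier M" "b \<in> carrier M" "e \<in> carrier M"
    using m g by (simp_all add: abe)
  note closed = multilinear_map_closed[OF f(1)]
  have f_closed [simp]: "f [x, y] \<in> carrier A" if "x \<in> carrier M" "y \<in> carrier M" for x y
    using that by (simp add: closed tuples_def)
  have f_inv: "f [x \<triangleleft> g, y \<triangleleft> g] = f [x, y]"
    if "x \<in> carrier M" "y \<in> carrier M" "g \<in> carrier G" for x y g
    using invariant_mapD[OF f(2), of "[x, y]" g] that by (simp add: tuples_def)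
  have f_add1: "f [x \<oplus>\<^bsub>M\<^esub> x', y] = f [x, y] \<oplus>\<^bsub>A\<^esub> f [x', y]"
    if "x \<in> carrier M" "x' \<in> carrier M" "y \<in> carrier M" for x x' y
    using multilinear_map_add[OF f(1), of "[]" x "[y]" x'] that by (simp add: tuples_def)
  have f_diff2: "f [x, y \<ominus>\<^bsub>M\<^esub> y'] = f [x, y] \<ominus>\<^bsub>A\<^esub> f [x, y']"
    if "x \<in> carrier M" "y \<in> carrier M" "y' \<in> carrier M" for x y y'
    using multilinear_map_diff[OF M.abelian_group_axioms A.abelian_group_axioms f(1), of "[x]" y "[]" y'] that
    by (simp add: tuples_def)
  note face = hom_face_difference[where us = "alex_under G M act \<phi>" and os = "alex_over act \<phi>",
      OF A.abelian_group_axioms h xs _ alex_under_closed alex_over_closed]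
  note evaluate = birack_cochain_2[OF f] alex_under_affine
  have D0: "?h (?F 0 xs) = \<zero>\<^bsub>A\<^esub>"
  proof -
    have "?h (?F 0 xs) = f [b, e] \<ominus>\<^bsub>A\<^esub> f [b \<triangleleft> \<phi> g1, e \<triangleleft> \<phi> g1]"
      using face[of 0] m g
      by (simp add: xs_eq evaluate delta_central abe gact_diff del: alex_under.simps)
    then show ?thesis
      using g by (simp add: f_inv A.diff_self)
  qed
  have D1: "?h (?F 1 xs) = f [a, \<delta> g2 e]"
  proof -
    have "?h (?F 1 xs) = f [a \<oplus>\<^bsub>M\<^esub> b, e] \<ominus>\<^bsub>A\<^esub> f [a \<triangleleft> g2 \<oplus>\<^bsub>M\<^esub> b \<triangleleft> \<phi> g2, e \<triangleleft> \<phi> g2]"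
      using face[of 1] m g
      by (simp add: xs_eq evaluate delta_central abe under_minus_over diff_split[of m1 m2 m3, symmetric]
          del: alex_under.simps)
    also have "\<dots> = f [a, e] \<ominus>\<^bsub>A\<^esub> f [a \<triangleleft> g2, e \<triangleleft> \<phi> g2]"
      using g by (simp add: f_add1 f_inv A.diff_add_add A.diff_self)
    also have "\<dots> = f [a, \<delta> g2 e]"
      using twist_absorbed_last[OF f, of "[a]" e g2] g by (simp add: tuples_def)
    finally show ?thesis .
  qed
  have D2: "?h (?F 2 xs) = f [a, \<delta> g2 e]"
  proof -
    have "?h (?F 2 xs) = f [a, \<delta> g2 m2] \<ominus>\<^bsub>A\<^esub> f [a \<triangleleft> g3, \<delta> g2 (m2 \<ominus>\<^bsub>M\<^esub> e) \<triangleleft> g3]"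
      using face[of 2] m g
      by (simp add: xs_eq evaluate delta_conj abe under_minus_under del: alex_under.simps)
    then show ?thesis
      using m g by (simp add: f_inv delta_diff f_diff2 A.diff_diff_cancel)
  qed
  have F: "?F i xs \<in> carrier (free_Abelian_group ?S)" if "i \<le> 2" for i
    using xs that by (intro face_difference_closed alex_under_closed alex_over_closed)
  have sum: "(\<Sum>i<Suc 2. frag_cmul ((-1) ^ i) (?F i xs)) = ?F 0 xs - (?F 1 xs - ?F 2 xs)"
    by (simp add: numeral_2_eq_2)
  have F12: "?F 1 xs - ?F 2 xs \<in> carrier (free_Abelian_group ?S)"
    using F[of 1] F[of 2] keys_diff[of "?F 1 xs" "?F 2 xs"] by auto
  show "?h (\<Sum>i<Suc 2. frag_cmul ((-1) ^ i) (?F i xs)) = \<zero>\<^bsub>A\<^esub>"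
    unfolding sum
    using hom_free_Abelian_group_diff[OF A.abelian_group_axioms h F[of 0] F12]
      hom_free_Abelian_group_diff[OF A.abelian_group_axioms h F[of 1] F[of 2]] g
    by (simp add: D0 D1[simplified] D2 A.diff_self)
qed simp_all

text \<open>
  As for 2-cocycles, the difference of faces at the first entry vanishes. Deleting the third entry
  splits \<open>m\<^sub>2 - m\<^sub>4\<close> into \<open>b = m\<^sub>2 - m\<^sub>3\<close> and \<open>c = m\<^sub>3 - m\<^sub>4\<close>;
  the \<open>c\<close>-part yields the value at the second entry and the \<open>b\<close>-part the value at the fourth.
\<close>

lemma birack_cocycle_3:
  assumes f: "multilinear_map 3 M A f" "invariant_map G M act 3 f"
  shows "birack_cocycle (alex_under G M act \<phi>) (alex_over act \<phi>) 3 (alex_carrier G M) A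
    (birack_cochain G M act \<phi> A 3 f)"
proof (rule birack_cocycleI[OF A.abelian_group_axioms _ birack_cochain_hom[OF f]
      alex_under_closed alex_over_closed])
  let ?h = "birack_cochain G M act \<phi> A 3 f"
  let ?S = "tuples 3 (alex_carrier G M)"
  let ?F = "face_difference (alex_under G M act \<phi>) (alex_over act \<phi>)"
  have h: "?h \<in> hom (free_Abelian_group ?S) (add_monoid A)"
    using birack_cochain_hom[OF f] by (simp add: birack_chains_def)
  fix xs assume xs: "xs \<in> tuples (Suc 3) (alex_carrier G M)"
  then obtain m1 g1 m2 g2 m3 g3 m4 g4 where xs_eq: "xs = [(m1, g1), (m2, g2), (m3, g3), (m4, g4)]"
    and m: "m1 \<in> carrier M" "m2 \<in> carrier M" "m3 \<in> carrier M" "m4 \<in> carrier M"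
    and g: "g1 \<in> carrier G" "g2 \<in> carrier G" "g3 \<in> carrier G" "g4 \<in> carrier G"
    by (auto simp: tuples_def alex_carrier_def length_Suc_conv numeral_3_eq_3)
  define a b c e p where abcep: "a = m1 \<ominus>\<^bsub>M\<^esub> m2" "b = m2 \<ominus>\<^bsub>M\<^esub> m3" "c = m3 \<ominus>\<^bsub>M\<^esub> m4"
    "e = \<delta> g4 m4" "p = \<delta>' g2 (m1 \<ominus>\<^bsub>M\<^esub> m2)"
  have abcep_closed [simp]: "a \<in> carrier M" "b \<in> carrier M" "c \<in> carrier M" "e \<in> carrier M" "p \<in> carrier M"
    using m g by (simp_all add: abcep)
  have p: "p = \<delta>' g2 a"
    by (simp add: abcep)
  have f_closed [simp]: "f [x, y, z] \<in> carrier A"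
    if "x \<in> carrier M" "y \<in> carrier M" "z \<in> carrier M" for x y z
    using that by (simp add: multilinear_map_closed[OF f(1)] tuples_def)
  have f_inv: "f [x \<triangleleft> g, y \<triangleleft> g, z \<triangleleft> g] = f [x, y, z]"
    if "x \<in> carrier M" "y \<in> carrier M" "z \<in> carrier M" "g \<in> carrier G" for x y z g
    using invariant_mapD[OF f(2), of "[x, y, z]" g] that by (simp add: tuples_def)
  have f_add1: "f [x \<oplus>\<^bsub>M\<^esub> x', y, z] = f [x, y, z] \<oplus>\<^bsub>A\<^esub> f [x', y, z]"
    if "x \<in> carrier M" "x' \<in> carrier M" "y \<in> carrier M" "z \<in> carrier M" for x x' y z
    using multilinear_map_add[OF f(1), of "[]" x "[y, z]" x'] that by (simp add: tuples_def)
  have f_add2: "f [x, y \<oplus>\<^bsub>M\<^esub> y', z] = f [x, y, z] \<oplus>\<^bsub>A\<^esub> f [x, y', z]"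
    if "x \<in> carrier M" "y \<in> carrier M" "y' \<in> carrier M" "z \<in> carrier M" for x y y' z
    using multilinear_map_add[OF f(1), of "[x]" y "[z]" y'] that by (simp add: tuples_def)
  note f_diff = multilinear_map_diff[OF M.abelian_group_axioms A.abelian_group_axioms f(1)]
  have f_diff1: "f [x \<ominus>\<^bsub>M\<^esub> x', y, z] = f [x, y, z] \<ominus>\<^bsub>A\<^esub> f [x', y, z]"
    if "x \<in> carrier M" "x' \<in> carrier M" "y \<in> carrier M" "z \<in> carrier M" for x x' y z
    using f_diff[of "[]" x "[y, z]" x'] that by (simp add: tuples_def)
  have f_diff3: "f [x, y, z \<ominus>\<^bsub>M\<^esub> z'] = f [x, y, z] \<ominus>\<^bsub>A\<^esub> f [x, y, z']"
    if "x \<in> carrier M" "y \<in> carrier M" "z \<in> carrier M" "z' \<in> carrier M" for x y z z'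
    using f_diff[of "[x, y]" z "[]" z'] that by (simp add: tuples_def)
  note face = hom_face_difference[where us = "alex_under G M act \<phi>" and os = "alex_over act \<phi>",
      OF A.abelian_group_axioms h xs _ alex_under_closed alex_over_closed]
  note evaluate = birack_cochain_3[OF f] alex_under_affine
  have D0: "?h (?F 0 xs) = \<zero>\<^bsub>A\<^esub>"
  proof -
    have "?h (?F 0 xs) = f [\<delta>' g3 b, c, e] \<ominus>\<^bsub>A\<^esub> f [\<delta>' g3 b \<triangleleft> \<phi> g1, c \<triangleleft> \<phi> g1, e \<triangleleft> \<phi> g1]"
      using face[of 0] m g
      by (simp add: xs_eq evaluate delta_central delta'_central[symmetric] abcep gact_diff
          del: alex_under.simps)
    then show ?thesis
      using g by (simp add: f_inv A.diff_self)
  qed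
  have D1: "?h (?F 1 xs) = f [\<delta>' g3 p, c, e]"
  proof -
    have "?h (?F 1 xs) = f [\<delta>' g3 (a \<oplus>\<^bsub>M\<^esub> b), c, e]
        \<ominus>\<^bsub>A\<^esub> f [\<delta>' g3 (a \<triangleleft> g2 \<oplus>\<^bsub>M\<^esub> b \<triangleleft> \<phi> g2), c \<triangleleft> \<phi> g2, e \<triangleleft> \<phi> g2]"
      using face[of 1] m g
      by (simp add: xs_eq evaluate delta_central abcep gact_diff[symmetric] under_minus_over
          diff_split[of m1 m2 m3, symmetric] del: alex_under.simps)
    also have "\<dots> = f [\<delta>' g3 a, c, e] \<ominus>\<^bsub>A\<^esub> f [\<delta>' g3 (a \<triangleleft> g2), c \<triangleleft> \<phi> g2, e \<triangleleft> \<phi> g2]"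
      using g by (simp add: delta'_add delta'_central f_add1 f_inv A.diff_add_add A.diff_self)
    \<comment> \<open>As \<open>g2\<close> and \<open>g3\<close> need not commute, \<open>g2\<close> cannot be moved out of \<open>\<delta>' g3\<close>; its
      central factor \<open>\<phi> g2\<close> can, and invariance then removes that factor.\<close>
    also have "\<delta>' g3 (a \<triangleleft> g2) = \<delta>' g3 (a \<triangleleft> (inv (\<phi> g2) \<otimes> g2)) \<triangleleft> \<phi> g2"
      using g by (simp add: delta'_central[symmetric] gact_gact inv_phi_central G.m_assoc)
    also have "f [\<delta>' g3 a, c, e] \<ominus>\<^bsub>A\<^esub> f [\<dots>, c \<triangleleft> \<phi> g2, e \<triangleleft> \<phi> g2] = f [\<delta>' g3 p, c, e]"
      using g by (simp add: f_inv f_diff1[symmetric] delta'_diff[symmetric] p \<delta>'_def[of g2] defect_def)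
    finally show ?thesis .
  qed
  have D2: "?h (?F 2 xs) = f [\<delta>' g3 p, c, e] \<oplus>\<^bsub>A\<^esub> f [p, b, \<delta> g3 e]"
  proof -
    have "?h (?F 2 xs) = f [p, b \<oplus>\<^bsub>M\<^esub> c, e]
        \<ominus>\<^bsub>A\<^esub> f [p \<triangleleft> g3, b \<triangleleft> g3 \<oplus>\<^bsub>M\<^esub> c \<triangleleft> \<phi> g3, e \<triangleleft> \<phi> g3]"
      using face[of 2] m g
      by (simp add: xs_eq evaluate delta_central delta'_conj abcep under_minus_under under_minus_over
          diff_split[of m2 m3 m4, symmetric] del: alex_under.simps)
    also have "\<dots> = (f [p, b, e] \<ominus>\<^bsub>A\<^esub> f [p \<triangleleft> g3, b \<triangleleft> g3, e \<triangleleft> \<phi> g3])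
        \<oplus>\<^bsub>A\<^esub> (f [p, c, e] \<ominus>\<^bsub>A\<^esub> f [p \<triangleleft> g3, c \<triangleleft> \<phi> g3, e \<triangleleft> \<phi> g3])"
      using g by (simp add: f_add2 A.diff_add_add)
    also have "\<dots> = f [\<delta>' g3 p, c, e] \<oplus>\<^bsub>A\<^esub> f [p, b, \<delta> g3 e]"
      using twist_absorbed_last[OF f, of "[p, b]" e g3] twist_absorbed_first[OF f, of p "[c, e]" g3] g
      by (simp add: tuples_def A.a_comm)
    finally show ?thesis .
  qed
  have D3: "?h (?F 3 xs) = f [p, b, \<delta> g3 e]"
  proof -
    have "?h (?F 3 xs) = f [p, b, \<delta> g3 m3] \<ominus>\<^bsub>A\<^esub> f [p \<triangleleft> g4, b \<triangleleft> g4, \<delta> g3 (m3 \<ominus>\<^bsub>M\<^esub> e) \<triangleleft> g4]"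
      using face[of 3] m g
      by (simp add: xs_eq evaluate delta_conj delta'_conj abcep under_minus_under
          del: alex_under.simps)
    then show ?thesis
      using m g by (simp add: f_inv delta_diff f_diff3 A.diff_diff_cancel)
  qed
  have F: "?F i xs \<in> carrier (free_Abelian_group ?S)" if "i \<le> 3" for i
    using xs that by (intro face_difference_closed alex_under_closed alex_over_closed)
  have sum: "(\<Sum>i<Suc 3. frag_cmul ((-1) ^ i) (?F i xs)) = ?F 0 xs - (?F 1 xs - (?F 2 xs - ?F 3 xs))"
    by (simp add: numeral_3_eq_3 numeral_2_eq_2)
  have F23: "?F 2 xs - ?F 3 xs \<in> carrier (free_Abelian_group ?S)"
    using F[of 2] F[of 3] keys_diff[of "?F 2 xs" "?F 3 xs"] by auto
  then have F123: "?F 1 xs - (?F 2 xs - ?F 3 xs) \<in> carrier (free_Abelian_group ?S)"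
    using F[of 1] keys_diff[of "?F 1 xs" "?F 2 xs - ?F 3 xs"] by auto
  note h_diff = hom_free_Abelian_group_diff[OF A.abelian_group_axioms h]
  have "?h (?F 2 xs - ?F 3 xs) = f [\<delta>' g3 p, c, e]"
    using h_diff[OF F[of 2] F[of 3]] g by (simp add: D2 D3 A.diff_add_cancel_right)
  then show "?h (\<Sum>i<Suc 3. frag_cmul ((-1) ^ i) (?F i xs)) = \<zero>\<^bsub>A\<^esub>"
    unfolding sum
    using h_diff[OF F[of 0] F123] h_diff[OF F[of 1] F23] g
    by (simp add: D0 D1[simplified] A.diff_self)
qed simp_all

end

theorem theorem3p5:
  fixes G :: "('g, 'b) monoid_scheme"
    and M :: "('m, 'c) ring_scheme"
    and act :: "'m \<Rightarrow> ('g \<Rightarrow>\<^sub>0 int) \<Rightarrow> 'm"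
    and \<phi> :: "'g \<Rightarrow> 'g"
    and A :: "('a, 'd) ring_scheme"
  assumes "group G"
    and "right_module (group_ring G) M act"
    and "\<phi> \<in> hom G (G\<lparr>carrier := center G\<rparr>)"
    and "abelian_group A"
  defines "X \<equiv> alex_carrier G M"
    and "us \<equiv> alex_under G M act \<phi>"
    and "os \<equiv> alex_over act \<phi>"
  shows
    "(\<forall>f. multilinear_map 2 M A f \<and> invariant_map G M act 2 f \<longrightarrow>
        birack_cocycle us os 2 X A (birack_cochain G M act \<phi> A 2 f) \<and>
        (\<forall>m\<^sub>1 g\<^sub>1 m\<^sub>2 g\<^sub>2. (m\<^sub>1, g\<^sub>1) \<in> X \<and> (m\<^sub>2, g\<^sub>2) \<in> X \<longrightarrow>
          birack_cochain G M act \<phi> A 2 f (frag_of [(m\<^sub>1, g\<^sub>1), (m\<^sub>2, g\<^sub>2)]) =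
            f [m\<^sub>1 \<ominus>\<^bsub>M\<^esub> m\<^sub>2,
               act m\<^sub>2 (frag_of \<one>\<^bsub>G\<^esub> - frag_of (\<phi> g\<^sub>2 \<otimes>\<^bsub>G\<^esub> inv\<^bsub>G\<^esub> g\<^sub>2))])) \<and>
     (\<forall>f. multilinear_map 3 M A f \<and> invariant_map G M act 3 f \<longrightarrow>
        birack_cocycle us os 3 X A (birack_cochain G M act \<phi> A 3 f) \<and>
        (\<forall>m\<^sub>1 g\<^sub>1 m\<^sub>2 g\<^sub>2 m\<^sub>3 g\<^sub>3. (m\<^sub>1, g\<^sub>1) \<in> X \<and> (m\<^sub>2, g\<^sub>2) \<in> X \<and> (m\<^sub>3, g\<^sub>3) \<in> X \<longrightarrow>
          birack_cochain G M act \<phi> A 3 f (frag_of [(m\<^sub>1, g\<^sub>1), (m\<^sub>2, g\<^sub>2), (m\<^sub>3, g\<^sub>3)]) =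
            f [act (m\<^sub>1 \<ominus>\<^bsub>M\<^esub> m\<^sub>2) (frag_of \<one>\<^bsub>G\<^esub> - frag_of (inv\<^bsub>G\<^esub> (\<phi> g\<^sub>2) \<otimes>\<^bsub>G\<^esub> g\<^sub>2)),
               m\<^sub>2 \<ominus>\<^bsub>M\<^esub> m\<^sub>3,
               act m\<^sub>3 (frag_of \<one>\<^bsub>G\<^esub> - frag_of (\<phi> g\<^sub>3 \<otimes>\<^bsub>G\<^esub> inv\<^bsub>G\<^esub> g\<^sub>3))]))"
proof -
  interpret alexander_data G M A act \<phi>
    using assms(1-4) by (intro alexander_data.intro alexander_data_axioms.intro)
  have mem_carrier: "(m, g) \<in> alex_carrier G M \<longleftrightarrow> m \<in> carrier M \<and> g \<in> carrier G" for m g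
    by (simp add: alex_carrier_def)
  show ?thesis
    unfolding X_def us_def os_def
    by (simp add: mem_carrier birack_cocycle_2 birack_cocycle_3 birack_cochain_2 birack_cochain_3
        act_one_diff \<delta>_def \<delta>'_def)
qed

end
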